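(* Let $(B,g_B)$ and $(F,g_F)$ be Riemannian manifolds of dimensions $n_1=\dim B$ and $n_2=\dim F$, let $n=n_1+n_2$, let $f$ be a positive differentiable function on $B$, and let $(M=B\times_f F,g)$ be the warped product manifold with metric $g=g_B+f^2g_F$. Let $\overline{M}_{m_1,m_2}$ be the Clifford torus $S^{m_1}\big(\sqrt{\tfrac{m_1}{m}}\big)\times S^{m_2}\big(\sqrt{\tfrac{m_2}{m}}\big)$ with $2\le m_1\le\frac m2$, $m=m_1+m_2$, and $m\ge4$. Then there does not exist an isometric minimal immersion $\phi$ from $(M,g)$ to $\overline{M}_{m_1,m_2}$ such that $\frac{\triangle f}{f}(\pi_1(p))>\frac{n_1m}{m_1}$ for some $p\in M$.
   Context: Manifolds have positive dimension and "differentiable" means smooth. The warped product $M=B\times_f F$ is $B\times F$ with the metric $g$ given by $\|X\|^2=\|d\pi_1X\|^2+f^2(\pi_1(x))\|d\pi_2X\|^2$ for $X\in T_xM$, where $\pi_1:B\times F\to B$ and $\pi_2:B\times F\to F$ are the projections; functions on $B$ are regarded as functions on $M$ via $\pi_1$. $\mathcal{D}_1$ is the distribution on $M$ of vectors tangent to the lifts of $B$. Laplacian: $\triangle f=\sum_{i=1}^{n_1}\big((\nabla_{e_i}e_i)f-e_i^2f\big)$, where $e_1,\dots,e_{n_1}$ is a local orthonormal frame of $\mathcal{D}_1$ consisting of lifts of a local orthonormal frame of $B$ and $\nabla$ is the Levi-Civita connection of $(M,g)$; equivalently, $\triangle f=-\mathrm{div}(\mathrm{grad}\,f)$ computed on $(B,g_B)$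 (note the sign). An isometric immersion is minimal if its mean curvature vector $\overrightarrow{H}=\frac1n\sum_{i=1}^n h(e_i,e_i)$ vanishes identically, where $h$ is the second fundamental form and $e_1,\dots,e_n$ is a local orthonormal frame of $TM$. $S^k(r)$ denotes the $k$-dimensional round sphere of radius $r$ in $\mathbb{R}^{k+1}$ (constant sectional curvature $1/r^2$); the Clifford torus $\overline{M}_{m_1,m_2}\subset S^{m+1}(1)$ carries the Riemannian product metric. *)

theory Defs
  imports "HOL-Analysis.Analysis"
begin

section \<open>Smooth maps between Euclidean spaces\<close>

text \<open>Meant for open \<open>S\<close>. Since the directional derivatives are required to exist along every
  vector and to be again \<open>k\<close> times differentiable, \<open>Ck_on k S f\<close> is the usual notion of a map of
  class \<open>C^k\<close> on \<open>S\<close> when the domain is finite-dimensional.\<close>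

primrec Ck_on :: "nat \<Rightarrow> 'a::euclidean_space set \<Rightarrow> ('a \<Rightarrow> 'b::real_normed_vector) \<Rightarrow> bool" where
  "Ck_on 0 S f \<longleftrightarrow> continuous_on S f"
| "Ck_on (Suc k) S f \<longleftrightarrow>
     (\<forall>x\<in>S. f differentiable (at x)) \<and> (\<forall>v. Ck_on k S (\<lambda>x. frechet_derivative f (at x) v))"

definition smooth_on :: "'a::euclidean_space set \<Rightarrow> ('a \<Rightarrow> 'b::real_normed_vector) \<Rightarrow> bool" where
  "smooth_on S f \<longleftrightarrow> (\<forall>k. Ck_on k S f)"

section \<open>Smooth and Riemannian manifolds\<close>

text \<open>A manifold with points in \<open>'p\<close>, modelled on the Euclidean space \<open>'e\<close> (so its dimension is
  \<open>DIM('e)\<close>, which is positive), is given by its topology and an indexed atlas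
  \<open>(chart_dom i, chart i)\<close>, \<open>i \<in> charts\<close>. The values of \<open>chart i\<close> outside \<open>chart_dom i\<close> are
  irrelevant.\<close>

record ('p, 'i, 'e) manifold =
  mtop :: "'p topology"
  charts :: "'i set"
  chart_dom :: "'i \<Rightarrow> 'p set"
  chart :: "'i \<Rightarrow> 'p \<Rightarrow> 'e"

text \<open>A tangent vector at \<open>p\<close> is represented, in each chart \<open>i\<close> around \<open>p\<close>, by its coordinate
  vector in \<open>'e\<close>; \<open>metric i p v w\<close> is the inner product of the tangent vectors at \<open>p\<close> whose
  coordinate vectors with respect to chart \<open>i\<close> are \<open>v\<close> and \<open>w\<close>.\<close>

record ('p, 'i, 'e) riemannian = "('p, 'i, 'e) manifold" +
  metric :: "'i \<Rightarrow> 'p \<Rightarrow> 'e \<Rightarrow> 'e \<Rightarrow> real"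

definition points :: "('p, 'i, 'e, 'z) manifold_scheme \<Rightarrow> 'p set" where
  "points M = topspace (mtop M)"

definition chart_img :: "('p, 'i, 'e, 'z) manifold_scheme \<Rightarrow> 'i \<Rightarrow> 'e set" where
  "chart_img M i = chart M i ` chart_dom M i"

definition param :: "('p, 'i, 'e, 'z) manifold_scheme \<Rightarrow> 'i \<Rightarrow> 'e \<Rightarrow> 'p" where
  "param M i = inv_into (chart_dom M i) (chart M i)"

definition transition ::
  "('p, 'i, 'e, 'z) manifold_scheme \<Rightarrow> 'i \<Rightarrow> 'i \<Rightarrow> 'e \<Rightarrow> 'e" where
  "transition M i j = chart M j \<circ> param M i"

definition smooth_manifold :: "('p, 'i, 'e::euclidean_space, 'z) manifold_scheme \<Rightarrow> bool" where
  "smooth_manifold M \<longleftrightarrow>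
     Hausdorff_space (mtop M) \<and> second_countable (mtop M) \<and>
     (\<Union>i\<in>charts M. chart_dom M i) = points M \<and>
     (\<forall>i\<in>charts M. openin (mtop M) (chart_dom M i) \<and> open (chart_img M i) \<and>
        homeomorphic_map (subtopology (mtop M) (chart_dom M i)) (top_of_set (chart_img M i))
          (chart M i)) \<and>
     (\<forall>i\<in>charts M. \<forall>j\<in>charts M.
        smooth_on (chart M i ` (chart_dom M i \<inter> chart_dom M j)) (transition M i j))"

definition riemannian_manifold ::
  "('p, 'i, 'e::euclidean_space, 'z) riemannian_scheme \<Rightarrow> bool" where
  "riemannian_manifold M \<longleftrightarrow>
     smooth_manifold M \<and>
     (\<forall>i\<in>charts M. \<forall>p\<in>chart_dom M i.
        bilinear (metric M i p) \<and>
        (\<forall>v w. metric M i p v w = metric M i p w v) \<and>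
        (\<forall>v. v \<noteq> 0 \<longrightarrow> metric M i p v v > 0)) \<and>
     (\<forall>i\<in>charts M. \<forall>v w. smooth_on (chart_img M i) (\<lambda>y. metric M i (param M i y) v w)) \<and>
     (\<forall>i\<in>charts M. \<forall>j\<in>charts M. \<forall>p\<in>chart_dom M i \<inter> chart_dom M j. \<forall>v w.
        metric M i p v w =
          metric M j p (frechet_derivative (transition M i j) (at (chart M i p)) v)
                       (frechet_derivative (transition M i j) (at (chart M i p)) w))"

text \<open>Smooth maps from a manifold into a Euclidean space, in particular real-valued functions.\<close>

definition smooth_map ::
  "('p, 'i, 'e::euclidean_space, 'z) manifold_scheme \<Rightarrow> ('p \<Rightarrow> 'n::real_normed_vector) \<Rightarrow> bool" where
  "smooth_map M \<phi> \<longleftrightarrow> (\<forall>i\<in>charts M. smooth_on (chart_img M i) (\<phi> \<circ> param M i))"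

text \<open>In the product chart \<open>(i, j)\<close> the differentials of the two projections are
  \<open>(v1, v2) \<mapsto> v1\<close> and \<open>(v1, v2) \<mapsto> v2\<close>.\<close>

definition warped_product ::
  "('p, 'i, 'b) riemannian \<Rightarrow> ('p \<Rightarrow> real) \<Rightarrow> ('q, 'j, 'c) riemannian \<Rightarrow>
     ('p \<times> 'q, 'i \<times> 'j, 'b \<times> 'c) riemannian" where
  "warped_product B f F =
     \<lparr> mtop = prod_topology (mtop B) (mtop F),
       charts = charts B \<times> charts F,
       chart_dom = (\<lambda>(i, j). chart_dom B i \<times> chart_dom F j),
       chart = (\<lambda>(i, j) (p, q). (chart B i p, chart F j q)),
       metric = (\<lambda>(i, j) (p, q) (v1, v2) (w1, w2).
                   metric B i p v1 w1 + (f p)\<^sup>2 * metric F j q v2 w2) \<rparr>"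

section \<open>The Laplacian\<close>

text \<open>Below, \<open>G\<close> is a metric in local coordinates: \<open>G y v w\<close> is the inner product at the coordinate
  point \<open>y\<close>.\<close>

definition local_metric ::
  "('p, 'i, 'e, 'z) riemannian_scheme \<Rightarrow> 'i \<Rightarrow> 'e \<Rightarrow> 'e \<Rightarrow> 'e \<Rightarrow> real" where
  "local_metric M i y = metric M i (param M i y)"

definition grad ::
  "('e::euclidean_space \<Rightarrow> 'e \<Rightarrow> 'e \<Rightarrow> real) \<Rightarrow> ('e \<Rightarrow> real) \<Rightarrow> 'e \<Rightarrow> 'e" where
  "grad G u y = (THE X. \<forall>w. G y X w = frechet_derivative u (at y) w)"

text \<open>\<open>christoffel G y v w\<close> is the Levi-Civita derivative at \<open>y\<close> of the constant coordinate field \<open>w\<close>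
  in the direction \<open>v\<close>, as given by the Koszul formula for commuting fields.\<close>

definition christoffel ::
  "('e::euclidean_space \<Rightarrow> 'e \<Rightarrow> 'e \<Rightarrow> real) \<Rightarrow> 'e \<Rightarrow> 'e \<Rightarrow> 'e \<Rightarrow> 'e" where
  "christoffel G y v w = (THE X. \<forall>z.
     2 * G y X z = frechet_derivative (\<lambda>x. G x w z) (at y) v
                 + frechet_derivative (\<lambda>x. G x v z) (at y) w
                 - frechet_derivative (\<lambda>x. G x v w) (at y) z)"

definition levi_civita ::
  "('e::euclidean_space \<Rightarrow> 'e \<Rightarrow> 'e \<Rightarrow> real) \<Rightarrow> ('e \<Rightarrow> 'e) \<Rightarrow> 'e \<Rightarrow> 'e \<Rightarrow> 'e" where
  "levi_civita G X y v = frechet_derivative X (at y) v + christoffel G y v (X y)"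

text \<open>The divergence is the trace of the endomorphism \<open>v \<mapsto> \<nabla>\<^sub>v X\<close>; a trace may be
  computed in any basis, here the standard one.\<close>

definition divergence ::
  "('e::euclidean_space \<Rightarrow> 'e \<Rightarrow> 'e \<Rightarrow> real) \<Rightarrow> ('e \<Rightarrow> 'e) \<Rightarrow> 'e \<Rightarrow> real" where
  "divergence G X y = (\<Sum>b\<in>Basis. levi_civita G X y b \<bullet> b)"

text \<open>Note the sign. The value does not depend on the chart chosen around \<open>p\<close>.\<close>

definition laplacian ::
  "('p, 'i, 'e::euclidean_space, 'z) riemannian_scheme \<Rightarrow> ('p \<Rightarrow> real) \<Rightarrow> 'p \<Rightarrow> real" where
  "laplacian M u p =
     (let i = (SOME i. i \<in> charts M \<and> p \<in> chart_dom M i); G = local_metric M i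
      in - divergence G (grad G (u \<circ> param M i)) (chart M i p))"

section \<open>Minimal isometric immersions into submanifolds of Euclidean space\<close>

text \<open>The target is an embedded submanifold \<open>S\<close> of a Euclidean space \<open>'n\<close> with the induced metric.\<close>

definition tangent_space :: "'n::euclidean_space set \<Rightarrow> 'n \<Rightarrow> 'n set" where
  "tangent_space S x = {u. \<exists>\<gamma>. \<exists>\<epsilon>>0. smooth_on {-\<epsilon><..<\<epsilon>} \<gamma> \<and> \<gamma> ` {-\<epsilon><..<\<epsilon>} \<subseteq> S \<and> \<gamma> 0 = x \<and>
     (\<gamma> has_vector_derivative u) (at (0::real))}"

definition orth_proj :: "'n::euclidean_space set \<Rightarrow> 'n \<Rightarrow> 'n" where
  "orth_proj V x = (THE y. y \<in> V \<and> (\<forall>z\<in>V. orthogonal (x - y) z))"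

text \<open>The differential of \<open>\<phi>\<close> at \<open>p\<close>, in chart \<open>i\<close>.\<close>

definition dmap ::
  "('p, 'i, 'e::euclidean_space, 'z) manifold_scheme \<Rightarrow> ('p \<Rightarrow> 'n::euclidean_space) \<Rightarrow>
     'i \<Rightarrow> 'p \<Rightarrow> 'e \<Rightarrow> 'n" where
  "dmap M \<phi> i p = frechet_derivative (\<phi> \<circ> param M i) (at (chart M i p))"

text \<open>A map into an embedded submanifold is smooth iff it is smooth into the ambient space. The
  metric of the domain being positive definite, the last condition makes the differentials
  injective.\<close>

definition isometric_immersion ::
  "('p, 'i, 'e::euclidean_space, 'z) riemannian_scheme \<Rightarrow> 'n::euclidean_space set \<Rightarrow>
     ('p \<Rightarrow> 'n) \<Rightarrow> bool" where
  "isometric_immersion M S \<phi> \<longleftrightarrow>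
     smooth_map M \<phi> \<and> \<phi> ` points M \<subseteq> S \<and>
     (\<forall>i\<in>charts M. \<forall>p\<in>chart_dom M i. \<forall>v w.
        dmap M \<phi> i p v \<bullet> dmap M \<phi> i p w = metric M i p v w)"

definition normal_space ::
  "('p, 'i, 'e::euclidean_space, 'z) manifold_scheme \<Rightarrow> 'n::euclidean_space set \<Rightarrow>
     ('p \<Rightarrow> 'n) \<Rightarrow> 'i \<Rightarrow> 'p \<Rightarrow> 'n set" where
  "normal_space M S \<phi> i p =
     {u \<in> tangent_space S (\<phi> p). \<forall>v. orthogonal u (dmap M \<phi> i p v)}"

text \<open>\<open>ambient_derivative\<close> is the Levi-Civita derivative of \<open>S\<close>, i.e. the tangential part of the
  Euclidean derivative, of the field \<open>d\<phi>(w)\<close> along \<open>\<phi>\<close> in the direction \<open>v\<close>, where \<open>v\<close> and \<open>w\<close> are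
  constant in the chart \<open>i\<close>. The second fundamental form is its component normal to \<open>\<phi>\<close>.\<close>

definition ambient_derivative ::
  "('p, 'i, 'e::euclidean_space, 'z) manifold_scheme \<Rightarrow> 'n::euclidean_space set \<Rightarrow>
     ('p \<Rightarrow> 'n) \<Rightarrow> 'i \<Rightarrow> 'p \<Rightarrow> 'e \<Rightarrow> 'e \<Rightarrow> 'n" where
  "ambient_derivative M S \<phi> i p v w =
     orth_proj (tangent_space S (\<phi> p))
       (frechet_derivative (\<lambda>y. frechet_derivative (\<phi> \<circ> param M i) (at y) w)
          (at (chart M i p)) v)"

definition second_fundamental_form ::
  "('p, 'i, 'e::euclidean_space, 'z) manifold_scheme \<Rightarrow> 'n::euclidean_space set \<Rightarrow>
     ('p \<Rightarrow> 'n) \<Rightarrow> 'i \<Rightarrow> 'p \<Rightarrow> 'e \<Rightarrow> 'e \<Rightarrow> 'n" where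
  "second_fundamental_form M S \<phi> i p v w =
     orth_proj (normal_space M S \<phi> i p) (ambient_derivative M S \<phi> i p v w)"

definition orthonormal_frame_at ::
  "('p, 'i, 'e::euclidean_space, 'z) riemannian_scheme \<Rightarrow> 'i \<Rightarrow> 'p \<Rightarrow> 'e set \<Rightarrow> bool" where
  "orthonormal_frame_at M i p E \<longleftrightarrow>
     finite E \<and> card E = DIM('e) \<and>
     (\<forall>v\<in>E. \<forall>w\<in>E. metric M i p v w = (if v = w then 1 else 0))"

definition mean_curvature ::
  "('p, 'i, 'e::euclidean_space, 'z) riemannian_scheme \<Rightarrow> 'n::euclidean_space set \<Rightarrow>
     ('p \<Rightarrow> 'n) \<Rightarrow> 'i \<Rightarrow> 'p \<Rightarrow> 'e set \<Rightarrow> 'n" where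
  "mean_curvature M S \<phi> i p E =
     (1 / real DIM('e)) *\<^sub>R (\<Sum>e\<in>E. second_fundamental_form M S \<phi> i p e e)"

text \<open>The mean curvature vector depends neither on the chart nor on the orthonormal frame.\<close>

definition minimal_immersion ::
  "('p, 'i, 'e::euclidean_space, 'z) riemannian_scheme \<Rightarrow> 'n::euclidean_space set \<Rightarrow>
     ('p \<Rightarrow> 'n) \<Rightarrow> bool" where
  "minimal_immersion M S \<phi> \<longleftrightarrow>
     (\<forall>i\<in>charts M. \<forall>p\<in>chart_dom M i. \<forall>E.
        orthonormal_frame_at M i p E \<longrightarrow> mean_curvature M S \<phi> i p E = 0)"

text \<open>The metric induced by the inner product of \<open>'c \<times> 'd\<close> is the product of the round metrics.
  The factors are \<open>m1\<close>- and \<open>m2\<close>-dimensional when \<open>DIM('c) = m1 + 1\<close> and \<open>DIM('d) = m2 + 1\<close>.\<close>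

definition clifford_torus ::
  "nat \<Rightarrow> nat \<Rightarrow> ('c::euclidean_space \<times> 'd::euclidean_space) set" where
  "clifford_torus m1 m2 =
     sphere 0 (sqrt (real m1 / real (m1 + m2))) \<times> sphere 0 (sqrt (real m2 / real (m1 + m2)))"

end

theory Submission
  imports Defs
begin

text \<open>The idea is to bound the Laplacian of \<open>f\<close> by Chen's argument. In product coordinates the metric
  conditions on \<open>\<Phi> = \<phi> \<circ> param\<close> determine all inner products of a second derivative of \<open>\<Phi>\<close> with a
  first one; differentiating once more gives the Gauss equation for a plane spanned by a base vector
  \<open>v\<close> and a fibre vector \<open>z\<close>,
  \<open>\<bar>\<Phi>\<^sub>z\<^sub>v\<bar>\<^sup>2 - \<Phi>\<^sub>z\<^sub>z \<bullet> \<Phi>\<^sub>v\<^sub>v = (f\<^sub>v\<^sup>2 + f f\<^sub>v\<^sub>v) g\<^sub>F(z, z)\<close>.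
  Summing over orthonormal frames and writing \<open>P\<close> and \<open>Q\<close> for the traces of the second derivative
  over the base and the fibre directions, Cauchy-Schwarz bounds \<open>P \<bullet> Q\<close> from below. Minimality says
  that \<open>P\<close> and \<open>Q\<close> have opposite components normal to the immersion in the torus, so \<open>P \<bullet> Q\<close> is at
  most the part coming from the tangent space and from the two normals of the torus. The tangential
  part turns the Euclidean second derivatives of \<open>f\<close> into its Laplacian, and the torus normals
  contribute at most \<open>n\<^sub>1 n\<^sub>2 m / m\<^sub>1\<close>, where \<open>m / m\<^sub>1\<close> is the larger of the curvatures of the two
  spheres.\<close>

section \<open>Directional derivatives\<close>

definition dderiv :: "('a::real_normed_vector \<Rightarrow> 'b::real_normed_vector) \<Rightarrow> 'a \<Rightarrow> 'a \<Rightarrow> 'b" where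
  "dderiv g v x = frechet_derivative g (at x) v"

lemma dderiv_eqI:
  assumes "(g has_derivative g') (at x)"
  shows "dderiv g v x = g' v"
  using frechet_derivative_at[OF assms] by (simp add: dderiv_def)

lemma has_derivative_dderiv:
  assumes "g differentiable (at x)"
  shows "(g has_derivative (\<lambda>v. dderiv g v x)) (at x)"
  using assms unfolding frechet_derivative_works dderiv_def .

lemma linear_dderiv:
  assumes "g differentiable (at x)"
  shows "linear (\<lambda>v. dderiv g v x)"
  using has_derivative_linear[OF has_derivative_dderiv[OF assms]] .

lemma dderiv_cong:
  assumes "open S" and "x \<in> S" and "\<And>y. y \<in> S \<Longrightarrow> g y = h y" and "h differentiable (at x)"
  shows "dderiv g v x = dderiv h v x"
proof (rule dderiv_eqI)
  show "(g has_derivative (\<lambda>v. dderiv h v x)) (at x)"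
    by (rule has_derivative_transform_within_open[OF has_derivative_dderiv[OF assms(4)] assms(1,2)])
       (simp add: assms(3))
qed

lemma dderiv_const [simp]: "dderiv (\<lambda>x. c) v x = 0"
  by (simp add: dderiv_def)

lemma dderiv_constant_on:
  assumes "open S" and "x \<in> S" and "\<And>y. y \<in> S \<Longrightarrow> g y = c"
  shows "dderiv g v x = 0"
  using dderiv_cong[OF assms(1,2), of g "\<lambda>_. c"] assms(3) by simp

lemma dderiv_inner:
  fixes g h :: "'a::real_normed_vector \<Rightarrow> 'b::real_inner"
  assumes "g differentiable (at x)" and "h differentiable (at x)"
  shows "dderiv (\<lambda>y. g y \<bullet> h y) v x = dderiv g v x \<bullet> h x + g x \<bullet> dderiv h v x"
proof -
  have "((\<lambda>y. g y \<bullet> h y) has_derivative (\<lambda>v. g x \<bullet> dderiv h v x + dderiv g v x \<bullet> h x)) (at x)"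
    by (intro has_derivative_inner has_derivative_dderiv assms)
  from dderiv_eqI[OF this] show ?thesis by simp
qed

lemma dderiv_mult:
  fixes g h :: "'a::real_normed_vector \<Rightarrow> real"
  assumes "g differentiable (at x)" and "h differentiable (at x)"
  shows "dderiv (\<lambda>y. g y * h y) v x = dderiv g v x * h x + g x * dderiv h v x"
  using dderiv_inner[OF assms, of v] by simp

lemma dderiv_linear_comp:
  assumes "bounded_linear L" and "g differentiable (at x)"
  shows "dderiv (\<lambda>y. L (g y)) v x = L (dderiv g v x)"
  by (rule dderiv_eqI[OF bounded_linear.has_derivative[OF assms(1) has_derivative_dderiv[OF assms(2)]]])

lemma dderiv_fst_comp:
  assumes "g differentiable (at (fst x))"
  shows "dderiv (\<lambda>y. g (fst y)) v x = dderiv g (fst v) (fst x)"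
    and "(\<lambda>y. g (fst y)) differentiable (at x)"
proof -
  have "(g \<circ> fst has_derivative (\<lambda>v. dderiv g v (fst x)) \<circ> fst) (at x)"
    by (intro diff_chain_at has_derivative_dderiv[OF assms])
       (auto intro!: bounded_linear_imp_has_derivative bounded_linear_fst)
  then have h: "((\<lambda>y. g (fst y)) has_derivative (\<lambda>v. dderiv g (fst v) (fst x))) (at x)"
    by (simp add: o_def)
  show "dderiv (\<lambda>y. g (fst y)) v x = dderiv g (fst v) (fst x)"
    using dderiv_eqI[OF h] by simp
  show "(\<lambda>y. g (fst y)) differentiable (at x)"
    using h unfolding differentiable_def by blast
qed

lemma smooth_on_dderiv:
  assumes "smooth_on S g"
  shows "smooth_on S (dderiv g v)"
proof -
  have "Ck_on k S (dderiv g v)" for k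
  proof -
    have "Ck_on (Suc k) S g" using assms by (simp only: smooth_on_def)
    then show ?thesis by (simp add: dderiv_def[abs_def])
  qed
  then show ?thesis by (simp add: smooth_on_def)
qed

lemma smooth_on_differentiable:
  assumes "smooth_on S g" and "x \<in> S"
  shows "g differentiable (at x)"
proof -
  have "Ck_on (Suc 0) S g" using assms by (simp only: smooth_on_def)
  then show ?thesis using assms by simp
qed

lemma smooth_on_continuous_on:
  assumes "smooth_on S g"
  shows "continuous_on S g"
proof -
  have "Ck_on 0 S g" using assms by (simp only: smooth_on_def)
  then show ?thesis by simp
qed

section \<open>Symmetry of second derivatives\<close>

lemma has_real_derivative_line:
  fixes g :: "'a::euclidean_space \<Rightarrow> 'b::euclidean_space"
  assumes "g differentiable (at (x + t *\<^sub>R v))"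
  shows "((\<lambda>t. g (x + t *\<^sub>R v) \<bullet> c) has_real_derivative dderiv g v (x + t *\<^sub>R v) \<bullet> c) (at t)"
proof -
  have l: "((\<lambda>t. x + t *\<^sub>R v) has_derivative (\<lambda>t. t *\<^sub>R v)) (at t)"
    by (auto intro!: derivative_eq_intros)
  have "((\<lambda>t. g (x + t *\<^sub>R v)) has_derivative (\<lambda>s. dderiv g (s *\<^sub>R v) (x + t *\<^sub>R v))) (at t)"
    using diff_chain_at[OF l has_derivative_dderiv[OF assms]] by (simp add: o_def)
  then have "((\<lambda>t. g (x + t *\<^sub>R v) \<bullet> c) has_derivative
      (\<lambda>s. dderiv g (s *\<^sub>R v) (x + t *\<^sub>R v) \<bullet> c)) (at t)"
    by (rule has_derivative_inner_left)
  moreover have "(\<lambda>s. dderiv g (s *\<^sub>R v) (x + t *\<^sub>R v) \<bullet> c) = (*) (dderiv g v (x + t *\<^sub>R v) \<bullet> c)"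
    using linear_scale[OF linear_dderiv[OF assms]] by (auto simp: mult.commute)
  ultimately show ?thesis by (simp add: has_field_derivative_def)
qed

text \<open>The mean value theorem needs a real function, hence the pairing with \<open>c\<close>.
  It is applied along \<open>v\<close> to the increment of \<open>g\<close> over the step
  \<open>s *\<^sub>R w\<close>, then along \<open>w\<close> to \<open>dderiv g v\<close>. The second
  difference on the left is symmetric in \<open>v\<close> and \<open>w\<close>, and the commutation
  of derivatives rests on this.\<close>

lemma second_difference_mean_value:
  fixes g :: "'a::euclidean_space \<Rightarrow> 'b::euclidean_space"
  assumes "smooth_on S g" and "s > 0"
    and S: "\<And>a b. a \<in> {0..s} \<Longrightarrow> b \<in> {0..s} \<Longrightarrow> x + a *\<^sub>R v + b *\<^sub>R w \<in> S"
  shows "\<exists>a\<in>{0..s}. \<exists>b\<in>{0..s}.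
    (g (x + s *\<^sub>R v + s *\<^sub>R w) - g (x + s *\<^sub>R v) - g (x + s *\<^sub>R w) + g x) \<bullet> c
      = s * s * (dderiv (dderiv g v) w (x + a *\<^sub>R v + b *\<^sub>R w) \<bullet> c)"
proof -
  let ?q = "\<lambda>a. g ((x + s *\<^sub>R w) + a *\<^sub>R v) \<bullet> c - g (x + a *\<^sub>R v) \<bullet> c"
  let ?q' = "\<lambda>a. dderiv g v ((x + s *\<^sub>R w) + a *\<^sub>R v) \<bullet> c - dderiv g v (x + a *\<^sub>R v) \<bullet> c"
  have "\<exists>a>0. a < s \<and> ?q s - ?q 0 = (s - 0) * ?q' a"
  proof (rule MVT2)
    fix a :: real assume "0 \<le> a" "a \<le> s"
    then have "x + s *\<^sub>R w + a *\<^sub>R v \<in> S" "x + a *\<^sub>R v \<in> S"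
      using S[of a s] S[of a 0] assms(2) by (auto simp: algebra_simps)
    then show "DERIV ?q a :> ?q' a"
      by (intro DERIV_diff has_real_derivative_line smooth_on_differentiable[OF assms(1)])
  qed (use assms in auto)
  then obtain a where a: "0 < a" "a < s" "?q s - ?q 0 = s * ?q' a" by auto
  let ?r = "\<lambda>b. dderiv g v (x + a *\<^sub>R v + b *\<^sub>R w) \<bullet> c"
  let ?r' = "\<lambda>b. dderiv (dderiv g v) w (x + a *\<^sub>R v + b *\<^sub>R w) \<bullet> c"
  have "\<exists>b>0. b < s \<and> ?r s - ?r 0 = (s - 0) * ?r' b"
  proof (rule MVT2)
    fix b :: real assume "0 \<le> b" "b \<le> s"
    then have "x + a *\<^sub>R v + b *\<^sub>R w \<in> S" using S[of a b] a by auto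
    then show "DERIV ?r b :> ?r' b"
      by (intro has_real_derivative_line smooth_on_differentiable[OF smooth_on_dderiv[OF assms(1)]])
  qed (use assms in auto)
  then obtain b where b: "0 < b" "b < s" "?r s - ?r 0 = s * ?r' b" by auto
  have "?q' a = ?r s - ?r 0" by (simp add: algebra_simps)
  then have "?q s - ?q 0 = s * s * ?r' b" using a(3) b(3) by (simp only: mult.assoc)
  moreover have "?q s - ?q 0 =
     (g (x + s *\<^sub>R v + s *\<^sub>R w) - g (x + s *\<^sub>R v) - g (x + s *\<^sub>R w) + g x) \<bullet> c"
    by (simp add: inner_diff_left inner_add_left algebra_simps)
  ultimately show ?thesis using a b by (intro bexI[of _ a] bexI[of _ b]) auto
qed

lemma dderiv_commute:
  fixes g :: "'a::euclidean_space \<Rightarrow> 'b::euclidean_space"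
  assumes "open S" and "x \<in> S" and g: "smooth_on S g"
  shows "dderiv (dderiv g v) w x = dderiv (dderiv g w) v x"
proof (rule ccontr)
  let ?f1 = "dderiv (dderiv g v) w" and ?f2 = "dderiv (dderiv g w) v"
  assume "?f1 x \<noteq> ?f2 x"
  \<comment> \<open>Pairing with the difference \<open>c\<close> itself turns the assumed inequality
    into a gap \<open>2 * e\<close> between two real numbers, too wide for two errors below
    \<open>e\<close> to bridge.\<close>
  define c where "c = ?f1 x - ?f2 x"
  let ?h1 = "\<lambda>y. ?f1 y \<bullet> c" and ?h2 = "\<lambda>y. ?f2 y \<bullet> c"
  define e where "e = (c \<bullet> c) / 2"
  have cc: "?h1 x - ?h2 x = 2 * e" by (simp add: c_def e_def inner_diff_left)
  have e: "e > 0" using \<open>?f1 x \<noteq> ?f2 x\<close> by (simp add: e_def c_def)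
  have "continuous_on S ?h1" "continuous_on S ?h2"
    by (intro continuous_intros smooth_on_continuous_on smooth_on_dderiv g)+
  then have "isCont ?h1 x" "isCont ?h2 x" using assms(1,2) by (auto simp: continuous_on_eq_continuous_at)
  then have "(?h1 \<longlongrightarrow> ?h1 x) (nhds x)" "(?h2 \<longlongrightarrow> ?h2 x) (nhds x)"
    using tendsto_at_iff_tendsto_nhds[of ?h1 x] tendsto_at_iff_tendsto_nhds[of ?h2 x]
    by (simp_all only: isCont_def)
  then have "\<forall>\<^sub>F y in nhds x. dist (?h1 y) (?h1 x) < e" "\<forall>\<^sub>F y in nhds x. dist (?h2 y) (?h2 x) < e"
    using e unfolding tendsto_iff by blast+
  moreover have "\<forall>\<^sub>F y in nhds x. y \<in> S" using assms(1,2) by (rule eventually_nhds_in_open)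
  ultimately have "\<forall>\<^sub>F y in nhds x. dist (?h1 y) (?h1 x) < e \<and> dist (?h2 y) (?h2 x) < e \<and> y \<in> S"
    by (simp only: eventually_conj_iff)
  then obtain d where d: "d > 0"
    and D: "\<And>y. dist y x < d \<Longrightarrow> dist (?h1 y) (?h1 x) < e \<and> dist (?h2 y) (?h2 x) < e \<and> y \<in> S"
    unfolding eventually_nhds_metric by auto
  \<comment> \<open>With this \<open>s\<close> the parallelogram at \<open>x\<close> with sides
    \<open>s *\<^sub>R v\<close> and \<open>s *\<^sub>R w\<close> stays within distance
    \<open>d / 2\<close> of \<open>x\<close>; the summand 1 keeps the denominator positive when
    \<open>v\<close> and \<open>w\<close> vanish.\<close>
  define s where "s = d / (2 * (norm v + norm w + 1))"
  have N: "norm v + norm w + 1 > 0" by (smt (verit) norm_ge_zero)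
  have s: "s > 0" using d N by (simp add: s_def)
  have near: "dist (x + a *\<^sub>R v + b *\<^sub>R w) x < d" if "a \<in> {0..s}" "b \<in> {0..s}" for a b
  proof -
    have "dist (x + a *\<^sub>R v + b *\<^sub>R w) x = norm (a *\<^sub>R v + b *\<^sub>R w)" by (simp add: dist_norm add.assoc)
    also have "\<dots> \<le> a * norm v + b * norm w" using that by (intro norm_triangle_le) simp
    also have "\<dots> \<le> s * norm v + s * norm w"
      using that by (intro add_mono mult_right_mono) auto
    also have "\<dots> \<le> s * (norm v + norm w + 1)" using s by (simp add: algebra_simps)
    also have "\<dots> = d / 2" using N by (simp add: s_def divide_simps)
    finally show ?thesis using d by simp
  qed
  have mem: "x + a *\<^sub>R v + b *\<^sub>R w \<in> S" if "a \<in> {0..s}" "b \<in> {0..s}" for a b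
    using D[OF near[OF that]] by simp
  obtain a b where ab: "a \<in> {0..s}" "b \<in> {0..s}"
    "(g (x + s *\<^sub>R v + s *\<^sub>R w) - g (x + s *\<^sub>R v) - g (x + s *\<^sub>R w) + g x) \<bullet> c
      = s * s * ?h1 (x + a *\<^sub>R v + b *\<^sub>R w)"
    using second_difference_mean_value[OF g s, of x v w c, OF mem] by blast
  have near': "dist (x + b *\<^sub>R w + a *\<^sub>R v) x < d" if "a \<in> {0..s}" "b \<in> {0..s}" for a b
    using near[OF that] by (simp add: algebra_simps)
  have mem': "x + b *\<^sub>R w + a *\<^sub>R v \<in> S" if "b \<in> {0..s}" "a \<in> {0..s}" for a b
    using D[OF near'[OF that(2,1)]] by simp
  obtain b' a' where ab': "a' \<in> {0..s}" "b' \<in> {0..s}"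
    "(g (x + s *\<^sub>R w + s *\<^sub>R v) - g (x + s *\<^sub>R w) - g (x + s *\<^sub>R v) + g x) \<bullet> c
      = s * s * ?h2 (x + b' *\<^sub>R w + a' *\<^sub>R v)"
    using second_difference_mean_value[OF g s, of x w v c, OF mem'] by blast
  have "s * s * ?h1 (x + a *\<^sub>R v + b *\<^sub>R w) = s * s * ?h2 (x + b' *\<^sub>R w + a' *\<^sub>R v)"
    using ab(3) ab'(3) by (simp add: algebra_simps)
  then have "?h1 (x + a *\<^sub>R v + b *\<^sub>R w) = ?h2 (x + b' *\<^sub>R w + a' *\<^sub>R v)" using s by simp
  moreover have "dist (?h1 (x + a *\<^sub>R v + b *\<^sub>R w)) (?h1 x) < e" using D[OF near[OF ab(1,2)]] by simp
  moreover have "dist (?h2 (x + b' *\<^sub>R w + a' *\<^sub>R v)) (?h2 x) < e" using D[OF near'[OF ab'(1,2)]] by simp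
  ultimately show False using cc by (simp add: dist_real_def)
qed

lemma dderiv_add:
  assumes "g differentiable (at x)" and "h differentiable (at x)"
  shows "dderiv (\<lambda>y. g y + h y) v x = dderiv g v x + dderiv h v x"
  by (rule dderiv_eqI[OF has_derivative_add[OF has_derivative_dderiv[OF assms(1)] has_derivative_dderiv[OF assms(2)]]])

lemma dderiv_cmult:
  assumes "g differentiable (at x)"
  shows "dderiv (\<lambda>y. c * g y :: real) v x = c * dderiv g v x"
  by (rule dderiv_eqI[OF has_derivative_mult_right[OF has_derivative_dderiv[OF assms]]])

lemma dderiv_inner_zero:
  fixes g h :: "'a::real_normed_vector \<Rightarrow> 'b::real_inner"
  assumes "open S" and "x \<in> S" and "\<And>y. y \<in> S \<Longrightarrow> g y \<bullet> h y = 0"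
    and "g differentiable (at x)" and "h differentiable (at x)"
  shows "dderiv g v x \<bullet> h x + g x \<bullet> dderiv h v x = 0"
  using dderiv_constant_on[OF assms(1,2), of "\<lambda>y. g y \<bullet> h y" 0 v] assms(3)
  by (simp add: dderiv_inner[OF assms(4,5)])

lemma dderiv_snd_comp:
  assumes "g differentiable (at (snd x))"
  shows "dderiv (\<lambda>y. g (snd y)) v x = dderiv g (snd v) (snd x)"
    and "(\<lambda>y. g (snd y)) differentiable (at x)"
proof -
  have "(g \<circ> snd has_derivative (\<lambda>v. dderiv g v (snd x)) \<circ> snd) (at x)"
    by (intro diff_chain_at has_derivative_dderiv[OF assms])
       (auto intro!: bounded_linear_imp_has_derivative bounded_linear_snd)
  then have h: "((\<lambda>y. g (snd y)) has_derivative (\<lambda>v. dderiv g (snd v) (snd x))) (at x)"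
    by (simp add: o_def)
  show "dderiv (\<lambda>y. g (snd y)) v x = dderiv g (snd v) (snd x)"
    using dderiv_eqI[OF h] by simp
  show "(\<lambda>y. g (snd y)) differentiable (at x)"
    using h unfolding differentiable_def by blast
qed

text \<open>Obtained by differentiating the constant squared norm once and twice. With
  \<open>L\<close> one of the projections \<open>fst\<close> and \<open>snd\<close> it describes how
  a sphere factor curves: the component of a second derivative along the radius is determined by the
  first derivatives.\<close>

lemma dderiv_constant_norm:
  fixes g :: "'a::euclidean_space \<Rightarrow> 'b::euclidean_space" and L :: "'b \<Rightarrow> 'c::real_inner"
  assumes "open S" and x: "x \<in> S" and g: "smooth_on S g" and L: "bounded_linear L"
    and c: "\<And>y. y \<in> S \<Longrightarrow> L (g y) \<bullet> L (g y) = c"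
  shows "L (g x) \<bullet> L (dderiv g v x) = 0"
    and "L (g x) \<bullet> L (dderiv (dderiv g v) v x) = - (L (dderiv g v x) \<bullet> L (dderiv g v x))"
proof -
  have d: "(\<lambda>y. L (h y)) differentiable (at y)" if "smooth_on S h" "y \<in> S" for h :: "'a \<Rightarrow> 'b" and y
    using bounded_linear.has_derivative[OF L has_derivative_dderiv[OF smooth_on_differentiable[OF that]]]
    unfolding differentiable_def by blast
  have D: "dderiv (\<lambda>y. L (h y)) v y = L (dderiv h v y)" if "smooth_on S h" "y \<in> S" for h :: "'a \<Rightarrow> 'b" and y v
    by (rule dderiv_linear_comp[OF L smooth_on_differentiable[OF that]])
  have one: "L (g y) \<bullet> L (dderiv g v y) = 0" if y: "y \<in> S" for y
    using dderiv_constant_on[OF assms(1) y, of "\<lambda>y. L (g y) \<bullet> L (g y)" c v] c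
      dderiv_inner[OF d[OF g y] d[OF g y], of v] by (simp add: D[OF g y] inner_commute)
  show "L (g x) \<bullet> L (dderiv g v x) = 0" using one x by simp
  have g': "smooth_on S (dderiv g v)" by (rule smooth_on_dderiv[OF g])
  show "L (g x) \<bullet> L (dderiv (dderiv g v) v x) = - (L (dderiv g v x) \<bullet> L (dderiv g v x))"
    using dderiv_constant_on[OF assms(1) x, of "\<lambda>y. L (g y) \<bullet> L (dderiv g v y)" 0 v] one
      dderiv_inner[OF d[OF g x] d[OF g' x], of v] by (simp add: D[OF g x] D[OF g' x])
qed

text \<open>A product rule in which \<open>h\<close> is merely continuous: since \<open>k\<close>
  vanishes at \<open>x\<close>, the variation of \<open>h\<close> contributes only
  \<open>(h y - h x) * k' (y - x)\<close>, which is of smaller order than \<open>y - x\<close>. It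
  serves for the gradient coefficients, whose differentiability is still to be shown when it is
  applied.\<close>

lemma has_derivative_mult_vanishing:
  fixes h k :: "'a::real_normed_vector \<Rightarrow> real"
  assumes k: "(k has_derivative k') (at x)" and "k x = 0" and h: "isCont h x"
  shows "((\<lambda>y. h y * k y) has_derivative (\<lambda>v. h x * k' v)) (at x)"
proof -
  have bl: "bounded_linear k'" using k by (rule has_derivative_bounded_linear)
  obtain K where K: "\<And>v. norm (k' v) \<le> norm v * K" using bounded_linear.bounded[OF bl] by blast
  let ?q = "\<lambda>y. (k y - k x - k' (y - x)) /\<^sub>R norm (y - x)"
  have q: "(?q \<longlongrightarrow> 0) (at x)" using k by (auto simp: has_derivative_at_within)
  have h0: "((\<lambda>y. h y - h x) \<longlongrightarrow> 0) (at x)" using h by (simp add: isCont_def LIM_zero)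
  have "((\<lambda>y. (h y - h x) * (k' (y - x) /\<^sub>R norm (y - x))) \<longlongrightarrow> 0) (at x)"
  proof (rule Lim_null_comparison)
    show "((\<lambda>y. norm (h y - h x) * \<bar>K\<bar>) \<longlongrightarrow> 0) (at x)"
      using tendsto_mult_left_zero[OF tendsto_norm_zero[OF h0]] .
    have "norm (k' (y - x) /\<^sub>R norm (y - x)) \<le> \<bar>K\<bar>" for y
    proof (cases "y = x")
      case False
      have "norm (k' (y - x)) \<le> norm (y - x) * \<bar>K\<bar>"
        using K[of "y - x"] by (smt (verit) mult_left_mono norm_ge_zero)
      then show ?thesis using False by (simp add: divide_simps mult.commute)
    qed simp
    then show "\<forall>\<^sub>F y in at x. norm ((h y - h x) * (k' (y - x) /\<^sub>R norm (y - x))) \<le> norm (h y - h x) * \<bar>K\<bar>"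
      by (intro always_eventually allI) (simp only: norm_mult mult_left_mono[OF _ norm_ge_zero])
  qed
  moreover have "((\<lambda>y. h y * ?q y) \<longlongrightarrow> h x * 0) (at x)"
    using h q by (intro tendsto_mult) (auto simp: isCont_def)
  ultimately have "((\<lambda>y. h y * ?q y + (h y - h x) * (k' (y - x) /\<^sub>R norm (y - x))) \<longlongrightarrow> 0) (at x)"
    using tendsto_add by fastforce
  moreover have "(\<lambda>y. h y * ?q y + (h y - h x) * (k' (y - x) /\<^sub>R norm (y - x)))
      = (\<lambda>y. (h y * k y - h x * k x - h x * k' (y - x)) /\<^sub>R norm (y - x))"
    using assms(2) by (auto simp: fun_eq_iff algebra_simps)
  ultimately show ?thesis
    using bounded_linear_const_mult[OF bl] by (simp add: has_derivative_at_within)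
qed

section \<open>Gradient and divergence in coordinates\<close>

lemma bilinear_sum_left:
  fixes g :: "'a::euclidean_space \<Rightarrow> 'a \<Rightarrow> real"
  assumes "bilinear g"
  shows "g (\<Sum>i\<in>I. c i *\<^sub>R x i) w = (\<Sum>i\<in>I. c i * g (x i) w)"
proof -
  have l: "linear (\<lambda>x. g x w)" using assms by (simp add: bilinear_def)
  show ?thesis by (simp add: linear_sum[OF l] linear_scale[OF l])
qed

text \<open>Pairing a combination of \<open>E\<close> with a member of \<open>E\<close> returns its
  coefficient. This gives independence, then spanning by counting, and finally identifies the
  coefficients of \<open>v\<close>.\<close>

lemma orthonormal_expansion:
  fixes g :: "'a::euclidean_space \<Rightarrow> 'a \<Rightarrow> real"
  assumes g: "bilinear g" and E: "finite E" "card E = DIM('a)"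
    and on: "\<And>v w. v \<in> E \<Longrightarrow> w \<in> E \<Longrightarrow> g v w = (if v = w then 1 else 0)"
  shows "v = (\<Sum>e\<in>E. g v e *\<^sub>R e)"
proof -
  have coeff: "g (\<Sum>e\<in>E. c e *\<^sub>R e) w = c w" if "w \<in> E" for c w
  proof -
    have "g (\<Sum>e\<in>E. c e *\<^sub>R e) w = (\<Sum>e\<in>E. c e * g e w)" by (rule bilinear_sum_left[OF g])
    also have "\<dots> = (\<Sum>e\<in>E. if e = w then c e else 0)" by (intro sum.cong) (auto simp: on that)
    also have "\<dots> = c w" using E that by simp
    finally show ?thesis .
  qed
  have g0: "g 0 w = 0" for w by (rule bilinear_lzero[OF g])
  have "independent E"
  proof (rule independent_if_scalars_zero[OF E(1)])
    fix c x assume "(\<Sum>e\<in>E. c e *\<^sub>R e) = 0" "x \<in> E"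
    then show "c x = 0" using coeff[of x c] g0 by simp
  qed
  then have "UNIV \<subseteq> span E" using E by (intro card_ge_dim_independent) auto
  then obtain c where c: "v = (\<Sum>e\<in>E. c e *\<^sub>R e)" using span_finite[OF E(1)] by blast
  have "c e = g v e" if "e \<in> E" for e using coeff[OF that, of c] c by simp
  then have "(\<Sum>e\<in>E. c e *\<^sub>R e) = (\<Sum>e\<in>E. g v e *\<^sub>R e)" by (intro sum.cong) auto
  then show ?thesis using c by (rule trans[rotated])
qed

lemma linear_cmult: "linear f \<Longrightarrow> linear (\<lambda>v. c * f v :: real)"
  by (rule linearI) (simp_all add: linear_add linear_scale distrib_left)

lemma linear_cdivide: "linear f \<Longrightarrow> linear (\<lambda>v. f v / c :: real)"
  by (rule linearI) (simp_all add: linear_add linear_scale add_divide_distrib)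

text \<open>Positivity makes \<open>T\<close>, which expresses \<open>g\<close> through the standard
  inner product, injective and hence surjective in finite dimension. The lemma ensures that the
  definite descriptions in \<open>grad\<close> and \<open>christoffel\<close> denote.\<close>

lemma riesz_representation:
  fixes g :: "'a::euclidean_space \<Rightarrow> 'a \<Rightarrow> real"
  assumes g: "bilinear g" and pos: "\<And>v. v \<noteq> 0 \<Longrightarrow> g v v > 0" and l: "linear l"
  shows "\<exists>!X. \<forall>w. g X w = l w"
proof -
  have lin: "linear (\<lambda>x. g x w)" "linear (g x)" for x w using g by (auto simp: bilinear_def)
  define T where "T = (\<lambda>X. \<Sum>b\<in>Basis. g X b *\<^sub>R b)"
  have repr: "k w = (\<Sum>b\<in>Basis. k b *\<^sub>R b) \<bullet> w" if k: "linear k" for k :: "'a \<Rightarrow> real" and w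
  proof -
    have "k w = k (\<Sum>b\<in>Basis. (w \<bullet> b) *\<^sub>R b)" by (simp add: euclidean_representation)
    also have "\<dots> = (\<Sum>b\<in>Basis. k b *\<^sub>R b) \<bullet> w"
      by (simp add: linear_sum[OF k] linear_scale[OF k] inner_sum_left inner_commute[of w] mult.commute)
    finally show ?thesis .
  qed
  have T: "g X w = T X \<bullet> w" for X w unfolding T_def by (rule repr[OF lin(2)])
  have uniq: "X = Y" if "\<And>w. g X w = g Y w" for X Y
  proof -
    have "g (X - Y) (X - Y) = g X (X - Y) - g Y (X - Y)" by (rule linear_diff[OF lin(1)])
    also have "\<dots> = 0" by (simp only: that diff_self)
    finally have "X - Y = 0" using pos[of "X - Y"] by (metis less_irrefl)
    then show ?thesis by (simp only: right_minus_eq)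
  qed
  have "linear T"
    by (rule linearI) (simp_all add: T_def linear_add[OF lin(1)] linear_scale[OF lin(1)]
        scaleR_add_left sum.distrib scaleR_sum_right)
  moreover have "inj T"
  proof (rule injI)
    fix X Y assume "T X = T Y"
    then show "X = Y" by (intro uniq) (simp add: T)
  qed
  ultimately have "surj T" by (rule linear_inj_imp_surj)
  then obtain X where TX: "T X = (\<Sum>b\<in>Basis. l b *\<^sub>R b)" by (metis surjD)
  have X: "g X w = l w" for w unfolding T TX by (rule repr[OF l, symmetric])
  show ?thesis
  proof (rule ex1I)
    show "\<forall>w. g X w = l w" using X by simp
    fix Y assume "\<forall>w. g Y w = l w"
    then show "Y = X" by (intro uniq) (simp add: X)
  qed
qed

text \<open>Basis independence of the trace, in the form needed to pass from the standard basis in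
  \<open>divergence\<close> to a frame that is orthonormal for the metric.\<close>

lemma trace_sum:
  fixes A :: "'i \<Rightarrow> 'a::euclidean_space \<Rightarrow> real"
  assumes "\<And>e. e \<in> E \<Longrightarrow> linear (A e)"
  shows "(\<Sum>b\<in>Basis. (\<Sum>e\<in>E. A e b *\<^sub>R x e) \<bullet> b) = (\<Sum>e\<in>E. A e (x e))"
proof -
  have "(\<Sum>b\<in>Basis. (\<Sum>e\<in>E. A e b *\<^sub>R x e) \<bullet> b) = (\<Sum>b\<in>Basis. \<Sum>e\<in>E. A e ((x e \<bullet> b) *\<^sub>R b))"
    by (intro sum.cong refl) (simp add: inner_sum_left linear_scale[OF assms] mult.commute)
  also have "\<dots> = (\<Sum>e\<in>E. \<Sum>b\<in>Basis. A e ((x e \<bullet> b) *\<^sub>R b))" by (rule sum.swap)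
  also have "\<dots> = (\<Sum>e\<in>E. A e (x e))"
    by (intro sum.cong refl) (simp add: linear_sum[OF assms, symmetric] euclidean_representation)
  finally show ?thesis .
qed

section \<open>A Riemannian metric on a coordinate domain\<close>

locale riemannian_coordinates =
  fixes U :: "'e::euclidean_space set" and G :: "'e \<Rightarrow> 'e \<Rightarrow> 'e \<Rightarrow> real"
  assumes open_U: "open U"
    and smooth_G: "\<And>v w. smooth_on U (\<lambda>x. G x v w)"
    and bilinear_G: "\<And>x. x \<in> U \<Longrightarrow> bilinear (G x)"
    and sym_G: "\<And>x v w. x \<in> U \<Longrightarrow> G x v w = G x w v"
    and pos_G: "\<And>x v. x \<in> U \<Longrightarrow> v \<noteq> 0 \<Longrightarrow> G x v v > 0"
begin

abbreviation dG :: "'e \<Rightarrow> 'e \<Rightarrow> 'e \<Rightarrow> 'e \<Rightarrow> real" where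
  "dG v p q \<equiv> dderiv (\<lambda>x. G x p q) v"

lemma differentiable_G: "x \<in> U \<Longrightarrow> (\<lambda>x. G x v w) differentiable (at x)"
  by (rule smooth_on_differentiable[OF smooth_G])

lemma linear_dG1: "x \<in> U \<Longrightarrow> linear (\<lambda>v. dG v p q x)"
  by (rule linear_dderiv[OF differentiable_G])

lemma linear_dG2:
  assumes x: "x \<in> U"
  shows "linear (\<lambda>p. dG v p q x)"
proof (rule linearI)
  note l = bilinear_ladd[OF bilinear_G] bilinear_lmul[OF bilinear_G]
  note d = differentiable_G[OF x]
  fix a b c
  have "dG v (a + b) q x = dderiv (\<lambda>x. G x a q + G x b q) v x"
    by (rule dderiv_cong[OF open_U x l(1) differentiable_add[OF d d]])
  then show "dG v (a + b) q x = dG v a q x + dG v b q x" by (simp add: dderiv_add[OF d d])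
  have "dG v (c *\<^sub>R a) q x = dderiv (\<lambda>x. c * G x a q) v x"
    by (rule dderiv_cong[OF open_U x]) (simp_all add: l(2) d)
  then show "dG v (c *\<^sub>R a) q x = c *\<^sub>R dG v a q x" by (simp add: dderiv_cmult[OF d])
qed

lemma dG_sym: "x \<in> U \<Longrightarrow> dG v p q x = dG v q p x"
  by (rule dderiv_cong[OF open_U _ sym_G differentiable_G])

lemma linear_dG3: "x \<in> U \<Longrightarrow> linear (\<lambda>q. dG v p q x)"
  using linear_dG2[where v = v and q = p] dG_sym[where v = v and q = p] by simp

lemma grad_eq:
  assumes x: "x \<in> U" and u: "u differentiable (at x)"
  shows "G x (grad G u x) w = dderiv u w x"
  using theI'[OF riesz_representation[OF bilinear_G[OF x] pos_G[OF x] linear_dderiv[OF u]]]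
  by (simp add: grad_def dderiv_def)

lemma christoffel_eq:
  assumes x: "x \<in> U"
  shows "2 * G x (christoffel G x v w) z = dG v w z x + dG w v z x - dG z v w x"
proof -
  \<comment> \<open>Half of the Koszul expression is linear in \<open>z\<close>, so it is
    represented by a unique vector; moving the factor 2 across identifies that vector with
    \<open>christoffel\<close>.\<close>
  have "linear (\<lambda>z. (dG v w z x + dG w v z x - dG z v w x) / 2)"
    by (intro linearI) (simp_all add: linear_add[OF linear_dG3[OF x]] linear_add[OF linear_dG1[OF x]]
        linear_scale[OF linear_dG3[OF x]] linear_scale[OF linear_dG1[OF x]] field_simps)
  from theI'[OF riesz_representation[OF bilinear_G[OF x] pos_G[OF x] this]]
  have "G x (THE X. \<forall>z. G x X z = (dG v w z x + dG w v z x - dG z v w x) / 2) z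
      = (dG v w z x + dG w v z x - dG z v w x) / 2" by (rule spec)
  moreover have "(\<lambda>X. \<forall>z. G x X z = (dG v w z x + dG w v z x - dG z v w x) / 2)
      = (\<lambda>X. \<forall>z. 2 * G x X z = dG v w z x + dG w v z x - dG z v w x)"
    by (auto simp: fun_eq_iff field_simps)
  ultimately show ?thesis unfolding christoffel_def dderiv_def by simp
qed

end

text \<open>The members of \<open>E\<close> are constant coordinate vectors, orthonormal at the
  single point \<open>x\<close> only. No orthonormal frame field has to be constructed, at the price
  of derivatives of the metric in the formulas.\<close>

locale orthonormal_coordinates = riemannian_coordinates +
  fixes x :: "'a" and E :: "'a set"
  assumes x: "x \<in> U" and finite_E: "finite E" and card_E: "card E = DIM('a)"
    and orthonormal_E: "\<And>v w. v \<in> E \<Longrightarrow> w \<in> E \<Longrightarrow> G x v w = (if v = w then 1 else 0)"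
begin

lemma expansion: "v = (\<Sum>e\<in>E. G x v e *\<^sub>R e)"
  by (rule orthonormal_expansion[OF bilinear_G[OF x] finite_E card_E orthonormal_E])

lemma grad_at: "u differentiable (at x) \<Longrightarrow> grad G u x = (\<Sum>e\<in>E. dderiv u e x *\<^sub>R e)"
  using expansion[of "grad G u x"] by (simp add: grad_eq[OF x])

text \<open>Near \<open>x\<close> the coefficients \<open>a e y = G x (grad G u y) e\<close> solve the linear system
  \<open>a e y = du e y - (\<Sum>d\<in>E. a d y * (G y d e - G x d e))\<close>, whose matrix vanishes at \<open>x\<close>. So
  \<open>a\<close> is bounded, hence continuous at \<open>x\<close>, hence differentiable at \<open>x\<close>.\<close>

lemma has_derivative_grad_coeff:
  assumes u: "smooth_on U u" and e: "e \<in> E"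
  shows "((\<lambda>y. G x (grad G u y) e) has_derivative
    (\<lambda>v. dderiv (dderiv u e) v x - (\<Sum>d\<in>E. dderiv u d x * dG v d e x))) (at x)"
proof -
  define a where "a = (\<lambda>e y. G x (grad G u y) e)"
  define M where "M = (\<lambda>d e y. G y d e - G x d e)"
  have dM: "(M d e has_derivative (\<lambda>v. dG v d e x)) (at x)" for d e
    unfolding M_def by (auto intro!: derivative_eq_intros has_derivative_dderiv differentiable_G x)
  have M0: "M d e x = 0" for d e by (simp add: M_def)
  have du: "(dderiv u e has_derivative (\<lambda>v. dderiv (dderiv u e) v x)) (at x)" for e
    by (intro has_derivative_dderiv smooth_on_differentiable[OF smooth_on_dderiv[OF u] x])
  have cM: "(M d e \<longlongrightarrow> 0) (nhds x)" for d e
    using has_derivative_continuous[OF dM, of d e] M0 tendsto_at_iff_tendsto_nhds[of "M d e" x]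
    by (simp add: isCont_def)
  have cdu: "(dderiv u e \<longlongrightarrow> dderiv u e x) (nhds x)" for e
    using has_derivative_continuous[OF du, of e] tendsto_at_iff_tendsto_nhds[of "dderiv u e" x]
    by (simp add: isCont_def)
  have nearU: "\<forall>\<^sub>F y in nhds x. y \<in> U" by (rule eventually_nhds_in_open[OF open_U x])
  have system: "a e y = dderiv u e y - (\<Sum>d\<in>E. a d y * M d e y)" if y: "y \<in> U" for e y
  proof -
    have "dderiv u e y = G y (grad G u y) e"
      by (rule grad_eq[OF y smooth_on_differentiable[OF u y], symmetric])
    also have "\<dots> = G y (\<Sum>d\<in>E. a d y *\<^sub>R d) e" using expansion[of "grad G u y"] by (simp add: a_def)
    also have "\<dots> = (\<Sum>d\<in>E. a d y * G y d e)" by (rule bilinear_sum_left[OF bilinear_G[OF y]])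
    also have "\<dots> = (\<Sum>d\<in>E. a d y * M d e y) + (\<Sum>d\<in>E. a d y * G x d e)"
      by (simp add: M_def sum.distrib[symmetric] algebra_simps)
    also have "(\<Sum>d\<in>E. a d y * G x d e) = G x (\<Sum>d\<in>E. a d y *\<^sub>R d) e"
      by (rule bilinear_sum_left[OF bilinear_G[OF x], symmetric])
    also have "\<dots> = a e y" using expansion[of "grad G u y"] by (simp add: a_def)
    finally show ?thesis by simp
  qed
  \<comment> \<open>\<open>A\<close> measures the size of the coefficient vector, and
    \<open>C\<close> bounds the first derivatives of \<open>u\<close> near \<open>x\<close>; the
    summand 1 makes this bound strict at \<open>x\<close>.\<close>
  define A where "A = (\<lambda>y. \<Sum>e\<in>E. \<bar>a e y\<bar>)"
  define C where "C = (\<Sum>e\<in>E. \<bar>dderiv u e x\<bar>) + 1"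
  have "((\<lambda>y. \<Sum>e\<in>E. \<bar>M d e y\<bar>) \<longlongrightarrow> 0) (nhds x)" for d
    by (rule tendsto_null_sum) (rule tendsto_rabs_zero[OF cM])
  then have "\<forall>\<^sub>F y in nhds x. (\<Sum>e\<in>E. \<bar>M d e y\<bar>) < 1/2" for d
    by (rule order_tendstoD(2)) simp
  then have smallM: "\<forall>\<^sub>F y in nhds x. \<forall>d\<in>E. (\<Sum>e\<in>E. \<bar>M d e y\<bar>) < 1/2"
    using finite_E by (intro eventually_ball_finite) auto
  have "((\<lambda>y. \<Sum>e\<in>E. \<bar>dderiv u e y\<bar>) \<longlongrightarrow> (\<Sum>e\<in>E. \<bar>dderiv u e x\<bar>)) (nhds x)"
    by (intro tendsto_sum tendsto_rabs cdu)
  then have boundu: "\<forall>\<^sub>F y in nhds x. (\<Sum>e\<in>E. \<bar>dderiv u e y\<bar>) < C"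
    by (rule order_tendstoD(2)) (simp add: C_def)
  \<comment> \<open>Near \<open>x\<close> the perturbation sums are below \<open>1/2\<close>, so the
    linear system yields \<open>A y \<le> C + A y / 2\<close>.\<close>
  have boundA: "\<forall>\<^sub>F y in nhds x. A y \<le> 2 * C"
    using nearU smallM boundu
  proof eventually_elim
    case (elim y)
    have "A y \<le> (\<Sum>e\<in>E. \<bar>dderiv u e y\<bar> + (\<Sum>d\<in>E. \<bar>a d y\<bar> * \<bar>M d e y\<bar>))"
      unfolding A_def
    proof (rule sum_mono)
      fix e assume "e \<in> E"
      have "\<bar>\<Sum>d\<in>E. a d y * M d e y\<bar> \<le> (\<Sum>d\<in>E. \<bar>a d y\<bar> * \<bar>M d e y\<bar>)"
        using sum_abs[of "\<lambda>d. a d y * M d e y" E] by (simp add: abs_mult)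
      then show "\<bar>a e y\<bar> \<le> \<bar>dderiv u e y\<bar> + (\<Sum>d\<in>E. \<bar>a d y\<bar> * \<bar>M d e y\<bar>)"
        using system[OF elim(1), of e] by linarith
    qed
    also have "\<dots> = (\<Sum>e\<in>E. \<bar>dderiv u e y\<bar>) + (\<Sum>d\<in>E. \<bar>a d y\<bar> * (\<Sum>e\<in>E. \<bar>M d e y\<bar>))"
      by (simp add: sum.distrib sum_distrib_left) (rule sum.swap)
    also have "(\<Sum>d\<in>E. \<bar>a d y\<bar> * (\<Sum>e\<in>E. \<bar>M d e y\<bar>)) \<le> (\<Sum>d\<in>E. \<bar>a d y\<bar> * (1/2))"
      using elim(2) by (intro sum_mono mult_left_mono) (auto intro: less_imp_le)
    also have "\<dots> = A y / 2" by (simp add: A_def sum_distrib_right[symmetric] sum_divide_distrib)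
    finally show ?case using elim(3) by simp
  qed
  have ax: "a e x = dderiv u e x" for e using system[OF x, of e] by (simp add: M0)
  have "((\<lambda>y. a d y * M d e y) \<longlongrightarrow> 0) (nhds x)" if "d \<in> E" for d e
  proof (rule Lim_null_comparison)
    show "\<forall>\<^sub>F y in nhds x. norm (a d y * M d e y) \<le> 2 * C * \<bar>M d e y\<bar>"
      using boundA
    proof eventually_elim
      case (elim y)
      have "\<bar>a d y\<bar> \<le> A y" unfolding A_def using that finite_E by (intro member_le_sum) auto
      then show ?case using elim by (simp add: abs_mult mult_right_mono)
    qed
    show "((\<lambda>y. 2 * C * \<bar>M d e y\<bar>) \<longlongrightarrow> 0) (nhds x)"
      by (intro tendsto_mult_right_zero tendsto_rabs_zero cM)
  qed
  then have "((\<lambda>y. dderiv u e y - (\<Sum>d\<in>E. a d y * M d e y)) \<longlongrightarrow> dderiv u e x - 0) (nhds x)" for e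
    by (intro tendsto_diff cdu tendsto_null_sum)
  then have "(a e \<longlongrightarrow> a e x) (nhds x)" for e
    unfolding ax using nearU system
    by (subst tendsto_cong[where g = "\<lambda>y. dderiv u e y - (\<Sum>d\<in>E. a d y * M d e y)"])
       (auto elim: eventually_mono)
  then have cont: "isCont (a e) x" for e
    using tendsto_at_iff_tendsto_nhds[of "a e" x] by (simp add: isCont_def)
  \<comment> \<open>Each \<open>M d e\<close> vanishes at \<open>x\<close>, so continuity of the
    coefficients suffices to differentiate the products.\<close>
  have "((\<lambda>y. dderiv u e y - (\<Sum>d\<in>E. a d y * M d e y)) has_derivative
    (\<lambda>v. dderiv (dderiv u e) v x - (\<Sum>d\<in>E. a d x * dG v d e x))) (at x)"
    by (intro has_derivative_diff has_derivative_sum du has_derivative_mult_vanishing[OF dM M0 cont])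
  then have "(a e has_derivative
    (\<lambda>v. dderiv (dderiv u e) v x - (\<Sum>d\<in>E. a d x * dG v d e x))) (at x)"
    by (rule has_derivative_transform_within_open[OF _ open_U x]) (simp add: system)
  then have "(a e has_derivative
    (\<lambda>v. dderiv (dderiv u e) v x - (\<Sum>d\<in>E. dderiv u d x * dG v d e x))) (at x)"
    unfolding ax .
  then show ?thesis unfolding a_def .
qed

text \<open>The covariant derivative of the gradient is the sum of the derivative of its
  coefficients (\<open>?A\<close>) and a Christoffel part (\<open>?B\<close>);
  \<open>trace_sum\<close> evaluates both traces in the frame. The bracket multiplying
  \<open>dderiv u d x\<close> is the inner product of \<open>christoffel G x e e\<close> with
  \<open>d\<close>.\<close>

lemma divergence_grad:
  assumes u: "smooth_on U u"
  shows "divergence G (grad G u) x =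
    (\<Sum>e\<in>E. dderiv (dderiv u e) e x - (\<Sum>d\<in>E. dderiv u d x * (dG e d e x - dG d e e x / 2)))"
proof -
  let ?X = "grad G u x"
  let ?A = "\<lambda>e v. dderiv (dderiv u e) v x - (\<Sum>d\<in>E. dderiv u d x * dG v d e x)"
  let ?B = "\<lambda>e v. (dG v ?X e x + dG ?X v e x - dG e v ?X x) / 2"
  note du = smooth_on_differentiable[OF smooth_on_dderiv[OF u] x]
  have X: "?X = (\<Sum>e\<in>E. dderiv u e x *\<^sub>R e)" by (rule grad_at[OF smooth_on_differentiable[OF u x]])
  have "((\<lambda>y. \<Sum>e\<in>E. G x (grad G u y) e *\<^sub>R e) has_derivative (\<lambda>v. \<Sum>e\<in>E. ?A e v *\<^sub>R e)) (at x)"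
    by (intro has_derivative_sum has_derivative_scaleR_left has_derivative_grad_coeff u)
  then have "(grad G u has_derivative (\<lambda>v. \<Sum>e\<in>E. ?A e v *\<^sub>R e)) (at x)"
    using expansion by simp
  then have D: "frechet_derivative (grad G u) (at x) b = (\<Sum>e\<in>E. ?A e b *\<^sub>R e)" for b
    using dderiv_eqI[of "grad G u" _ x b] by (simp add: dderiv_def)
  have C: "christoffel G x b ?X = (\<Sum>e\<in>E. ?B e b *\<^sub>R e)" for b
  proof -
    have coeff: "G x (christoffel G x b ?X) e = ?B e b" for e
      using christoffel_eq[OF x, of b ?X e] by (subst eq_divide_eq) (simp add: mult.commute)
    show ?thesis by (rule trans[OF expansion]) (simp only: coeff)
  qed
  have linA: "linear (?A e)" for e
    by (intro linear_compose_sub linear_compose_sum ballI linear_cmult linear_dderiv[OF du] linear_dG1[OF x])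
  have linB: "linear (?B e)" for e
    by (intro linear_cdivide linear_compose_sub linear_compose_add linear_dG1[OF x] linear_dG2[OF x])
  have "divergence G (grad G u) x
      = (\<Sum>b\<in>Basis. (\<Sum>e\<in>E. ?A e b *\<^sub>R e) \<bullet> b) + (\<Sum>b\<in>Basis. (\<Sum>e\<in>E. ?B e b *\<^sub>R e) \<bullet> b)"
    by (simp add: divergence_def levi_civita_def D C inner_add_left sum.distrib)
  also have "\<dots> = (\<Sum>e\<in>E. ?A e e + ?B e e)"
    by (simp only: trace_sum[OF linA] trace_sum[OF linB] sum.distrib)
  also have "\<dots> = (\<Sum>e\<in>E. dderiv (dderiv u e) e x -
      (\<Sum>d\<in>E. dderiv u d x * (dG e d e x - dG d e e x / 2)))"
  proof (rule sum.cong[OF refl])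
    fix e
    \<comment> \<open>On the diagonal the first and third Koszul terms cancel by symmetry of the
      metric.\<close>
    have "?B e e = dG ?X e e x / 2" by (simp add: dG_sym[OF x, of e ?X e])
    also have "\<dots> = (\<Sum>d\<in>E. dderiv u d x * (dG d e e x / 2))"
      unfolding X by (simp add: linear_sum[OF linear_dG1[OF x]] linear_scale[OF linear_dG1[OF x]] sum_divide_distrib)
    finally show "?A e e + ?B e e = dderiv (dderiv u e) e x -
      (\<Sum>d\<in>E. dderiv u d x * (dG e d e x - dG d e e x / 2))"
      by (simp add: right_diff_distrib sum_subtractf)
  qed
  finally show ?thesis .
qed

end

section \<open>The Gauss equation of a warped product\<close>

text \<open>Pairs \<open>(v, 0)\<close> are base directions and pairs \<open>(0, z)\<close> fibre
  directions. The torus is absent at this stage: the identities concern only Euclidean inner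
  products of derivatives of \<Phi>.\<close>

locale warped_coordinates = base: riemannian_coordinates U GB + fibre: riemannian_coordinates V GF
  for U :: "'b::euclidean_space set" and GB and V :: "'f::euclidean_space set" and GF +
  fixes u :: "'b \<Rightarrow> real" and \<Phi> :: "'b \<times> 'f \<Rightarrow> 'n::euclidean_space"
  assumes smooth_\<Phi>: "smooth_on (U \<times> V) \<Phi>" and smooth_u: "smooth_on U u"
    and u_pos: "\<And>x. x \<in> U \<Longrightarrow> u x > 0"
    and isometric: "\<And>q v w. q \<in> U \<times> V \<Longrightarrow>
      dderiv \<Phi> v q \<bullet> dderiv \<Phi> w q
        = GB (fst q) (fst v) (fst w) + (u (fst q))\<^sup>2 * GF (snd q) (snd v) (snd w)"
begin

lemma open_UV: "open (U \<times> V)"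
  using base.open_U fibre.open_U by (rule open_Times)

abbreviation \<Phi>1 where "\<Phi>1 \<equiv> dderiv \<Phi>"
abbreviation \<Phi>2 where "\<Phi>2 v \<equiv> dderiv (dderiv \<Phi> v)"

lemma differentiable_\<Phi>1: "q \<in> U \<times> V \<Longrightarrow> \<Phi>1 v differentiable (at q)"
  by (rule smooth_on_differentiable[OF smooth_on_dderiv[OF smooth_\<Phi>]])

lemma differentiable_\<Phi>2: "q \<in> U \<times> V \<Longrightarrow> \<Phi>2 v w differentiable (at q)"
  by (rule smooth_on_differentiable[OF smooth_on_dderiv[OF smooth_on_dderiv[OF smooth_\<Phi>]]])

lemma \<Phi>2_commute: "q \<in> U \<times> V \<Longrightarrow> \<Phi>2 v w q = \<Phi>2 w v q"
  by (rule dderiv_commute[OF open_UV _ smooth_\<Phi>])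

lemma metric_base:
  "q \<in> U \<times> V \<Longrightarrow> \<Phi>1 (v, 0) q \<bullet> \<Phi>1 (w, 0) q = GB (fst q) v w"
  using isometric[of q "(v, 0)" "(w, 0)"] bilinear_lzero[OF fibre.bilinear_G, of "snd q"] by auto

lemma metric_mixed:
  "q \<in> U \<times> V \<Longrightarrow> \<Phi>1 (v, 0) q \<bullet> \<Phi>1 (0, z) q = 0"
  using isometric[of q "(v, 0)" "(0, z)"] bilinear_lzero[OF fibre.bilinear_G, of "snd q"]
    bilinear_rzero[OF base.bilinear_G, of "fst q"] by auto

lemma metric_fibre:
  "q \<in> U \<times> V \<Longrightarrow> \<Phi>1 (0, z) q \<bullet> \<Phi>1 (0, z') q = (u (fst q))\<^sup>2 * GF (snd q) z z'"
  using isometric[of q "(0, z)" "(0, z')"] bilinear_lzero[OF base.bilinear_G, of "fst q"] by auto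

text \<open>The base metric does not vary along the fibre, so the expression in the first claim is
  skew in \<open>v\<close> and \<open>w\<close>. Differentiating the orthogonality of base and fibre
  equates it, up to sign, with the expression in the second claim, which is symmetric. Both
  therefore vanish: the lifts of the base are totally geodesic in the warped product.\<close>

lemma
  assumes q: "q \<in> U \<times> V"
  shows \<Phi>2_mixed_base: "\<Phi>2 (v, 0) (0, z) q \<bullet> \<Phi>1 (w, 0) q = 0"
    and \<Phi>2_base_fibre: "\<Phi>2 (v, 0) (w, 0) q \<bullet> \<Phi>1 (0, z) q = 0"
proof -
  have skew: "\<Phi>2 (v, 0) (0, z) q \<bullet> \<Phi>1 (w, 0) q + \<Phi>1 (v, 0) q \<bullet> \<Phi>2 (w, 0) (0, z) q = 0"
  proof -
    have U: "fst q \<in> U" using q by auto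
    note g = smooth_on_differentiable[OF base.smooth_G U]
    have "dderiv (\<lambda>q. \<Phi>1 (v, 0) q \<bullet> \<Phi>1 (w, 0) q) (0, z) q = dderiv (\<lambda>q. GB (fst q) v w) (0, z) q"
      by (rule dderiv_cong[OF open_UV q metric_base dderiv_fst_comp(2)[OF g]])
    also have "\<dots> = 0"
      by (simp only: dderiv_fst_comp(1)[OF g] fst_conv linear_0[OF linear_dderiv[OF g]])
    finally show ?thesis
      by (simp only: dderiv_inner[OF differentiable_\<Phi>1[OF q] differentiable_\<Phi>1[OF q]])
  qed
  have mix: "\<Phi>2 (a, 0) (b, 0) q \<bullet> \<Phi>1 (0, z) q + \<Phi>1 (a, 0) q \<bullet> \<Phi>2 (0, z) (b, 0) q = 0" for a b
    by (rule dderiv_inner_zero[OF open_UV q _ differentiable_\<Phi>1[OF q] differentiable_\<Phi>1[OF q]])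
       (rule metric_mixed)
  show "\<Phi>2 (v, 0) (0, z) q \<bullet> \<Phi>1 (w, 0) q = 0" "\<Phi>2 (v, 0) (w, 0) q \<bullet> \<Phi>1 (0, z) q = 0"
    using skew mix[of v w] mix[of w v]
    by (simp_all add: \<Phi>2_commute[OF q, of "(0, z)"] \<Phi>2_commute[OF q, of "(w, 0)" "(v, 0)"]
        inner_commute)
qed

text \<open>Differentiating \<open>metric_fibre\<close> along \<open>v\<close> touches only the
  warping factor, whose square contributes the 2 cancelled by the two equal terms on the
  left.\<close>

lemma \<Phi>2_mixed_fibre:
  assumes q: "q \<in> U \<times> V"
  shows "\<Phi>2 (0, z) (v, 0) q \<bullet> \<Phi>1 (0, z) q = u (fst q) * dderiv u v (fst q) * GF (snd q) z z"
proof -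
  have U: "fst q \<in> U" and V: "snd q \<in> V" using q by auto
  note du = smooth_on_differentiable[OF smooth_u U] and dG = smooth_on_differentiable[OF fibre.smooth_G V]
  note d = dderiv_fst_comp(2)[OF du] dderiv_snd_comp(2)[OF dG] differentiable_mult
  have "dderiv (\<lambda>q. \<Phi>1 (0, z) q \<bullet> \<Phi>1 (0, z) q) (v, 0) q
      = dderiv (\<lambda>q. u (fst q) * u (fst q) * GF (snd q) z z) (v, 0) q"
    by (rule dderiv_cong[OF open_UV q]) (simp_all only: metric_fibre power2_eq_square, intro d)
  also have "\<dots> = 2 * (u (fst q) * dderiv u v (fst q) * GF (snd q) z z)"
    by (simp add: dderiv_mult d dderiv_fst_comp(1)[OF du] dderiv_snd_comp(1)[OF dG]
        linear_0[OF linear_dderiv[OF dG]] algebra_simps)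
  finally show ?thesis
    by (simp add: dderiv_inner[OF differentiable_\<Phi>1[OF q] differentiable_\<Phi>1[OF q]] inner_commute)
qed

text \<open>Since base and fibre directions stay orthogonal, this is minus the previous expression.
  It says that the fibres are umbilical in the warped product, bending along the gradient of
  \<open>u\<close>.\<close>

lemma \<Phi>2_fibre_base:
  assumes q: "q \<in> U \<times> V"
  shows "\<Phi>2 (0, z) (0, z) q \<bullet> \<Phi>1 (v, 0) q = - (u (fst q) * dderiv u v (fst q) * GF (snd q) z z)"
proof -
  have "\<Phi>2 (v, 0) (0, z) q \<bullet> \<Phi>1 (0, z) q + \<Phi>1 (v, 0) q \<bullet> \<Phi>2 (0, z) (0, z) q = 0"
    by (rule dderiv_inner_zero[OF open_UV q _ differentiable_\<Phi>1[OF q] differentiable_\<Phi>1[OF q]])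
       (rule metric_mixed)
  then show ?thesis
    using \<Phi>2_mixed_fibre[OF q, of z v]
    by (simp add: \<Phi>2_commute[OF q, of "(v, 0)"] inner_commute)
qed

text \<open>This is the Gauss equation for the mixed plane spanned by \<open>v\<close> and \<open>z\<close>, before the second
  derivatives are split into tangential and normal parts.\<close>

lemma gauss_mixed:
  assumes q: "q \<in> U \<times> V"
  shows "\<Phi>2 (0, z) (v, 0) q \<bullet> \<Phi>2 (0, z) (v, 0) q - \<Phi>2 (0, z) (0, z) q \<bullet> \<Phi>2 (v, 0) (v, 0) q
    = ((dderiv u v (fst q))\<^sup>2 + u (fst q) * dderiv (dderiv u v) v (fst q)) * GF (snd q) z z"
proof -
  have U: "fst q \<in> U" and V: "snd q \<in> V" using q by auto
  note du = smooth_on_differentiable[OF smooth_u U] and dG = smooth_on_differentiable[OF fibre.smooth_G V]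
    and du' = smooth_on_differentiable[OF smooth_on_dderiv[OF smooth_u] U]
  note d = dderiv_fst_comp(2)[OF du] dderiv_fst_comp(2)[OF du'] dderiv_snd_comp(2)[OF dG]
    differentiable_mult
  have "dderiv (\<lambda>q. \<Phi>2 (0, z) (v, 0) q \<bullet> \<Phi>1 (0, z) q) (v, 0) q
      = dderiv (\<lambda>q. u (fst q) * dderiv u v (fst q) * GF (snd q) z z) (v, 0) q"
    by (rule dderiv_cong[OF open_UV q]) (simp_all only: \<Phi>2_mixed_fibre, intro d)
  also have "\<dots> = ((dderiv u v (fst q))\<^sup>2 + u (fst q) * dderiv (dderiv u v) v (fst q)) * GF (snd q) z z"
    by (simp add: dderiv_mult d dderiv_fst_comp(1)[OF du] dderiv_fst_comp(1)[OF du']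
        dderiv_snd_comp(1)[OF dG] linear_0[OF linear_dderiv[OF dG]] power2_eq_square algebra_simps)
  finally have 1: "dderiv (\<Phi>2 (0, z) (v, 0)) (v, 0) q \<bullet> \<Phi>1 (0, z) q
      + \<Phi>2 (0, z) (v, 0) q \<bullet> \<Phi>2 (0, z) (v, 0) q
    = ((dderiv u v (fst q))\<^sup>2 + u (fst q) * dderiv (dderiv u v) v (fst q)) * GF (snd q) z z"
    by (simp add: dderiv_inner[OF differentiable_\<Phi>2[OF q] differentiable_\<Phi>1[OF q]])
  have 2: "dderiv (\<Phi>2 (v, 0) (v, 0)) (0, z) q \<bullet> \<Phi>1 (0, z) q
      + \<Phi>2 (v, 0) (v, 0) q \<bullet> \<Phi>2 (0, z) (0, z) q = 0"
    by (rule dderiv_inner_zero[OF open_UV q _ differentiable_\<Phi>2[OF q] differentiable_\<Phi>1[OF q]])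
       (rule \<Phi>2_base_fibre)
  \<comment> \<open>The third derivatives occurring in \<open>1\<close> and \<open>2\<close> agree,
    so they cancel when the two identities are subtracted.\<close>
  have "dderiv (\<Phi>2 (v, 0) (v, 0)) (0, z) q = dderiv (\<Phi>2 (v, 0) (0, z)) (v, 0) q"
    by (rule dderiv_commute[OF open_UV q smooth_on_dderiv[OF smooth_\<Phi>]])
  also have "\<dots> = dderiv (\<Phi>2 (0, z) (v, 0)) (v, 0) q"
    by (rule dderiv_cong[OF open_UV q \<Phi>2_commute differentiable_\<Phi>2[OF q]])
  finally show ?thesis using 1 2 by (simp add: inner_commute)
qed

end

section \<open>Minimality in a product of spheres\<close>

text \<open>Let \<open>R\<close> be the part of \<open>P\<close> orthogonal to all
  \<open>b i\<close>. By \<open>normal\<close> the corresponding part of \<open>Q\<close> pairs with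
  \<open>R\<close> to minus the squared norm of \<open>R\<close>, so it can only lower
  \<open>P \<bullet> Q\<close>. In the application the \<open>b i\<close> span the tangent space of
  the immersion and the normals of the torus.\<close>

lemma inner_le_orthonormal_sum:
  fixes P Q :: "'a::real_inner"
  assumes "finite I" and on: "\<And>i j. i \<in> I \<Longrightarrow> j \<in> I \<Longrightarrow> b i \<bullet> b j = (if i = j then 1 else 0)"
    and normal: "\<And>y. (\<And>i. i \<in> I \<Longrightarrow> y \<bullet> b i = 0) \<Longrightarrow> (P + Q) \<bullet> y = 0"
  shows "P \<bullet> Q \<le> (\<Sum>i\<in>I. (P \<bullet> b i) * (Q \<bullet> b i))"
proof -
  define R where "R = P - (\<Sum>i\<in>I. (P \<bullet> b i) *\<^sub>R b i)"
  have Rb: "R \<bullet> b j = 0" if "j \<in> I" for j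
  proof -
    have "(\<Sum>i\<in>I. (P \<bullet> b i) *\<^sub>R b i) \<bullet> b j = (\<Sum>i\<in>I. if i = j then P \<bullet> b i else 0)"
      unfolding inner_sum_left by (intro sum.cong) (auto simp: on that)
    also have "\<dots> = P \<bullet> b j" using assms(1) that by simp
    finally show ?thesis by (simp add: R_def inner_diff_left)
  qed
  have expand: "w \<bullet> R = w \<bullet> P - (\<Sum>i\<in>I. (P \<bullet> b i) * (w \<bullet> b i))" for w
    by (simp add: R_def inner_diff_right inner_sum_right)
  have "P \<bullet> R = R \<bullet> R" using expand[of R] Rb by (simp add: inner_commute)
  moreover have "(P + Q) \<bullet> R = 0" using normal Rb by blast
  ultimately have "Q \<bullet> R \<le> 0" using inner_ge_zero[of R] unfolding inner_add_left by linarith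
  then show ?thesis using expand[of Q] by (simp add: inner_commute)
qed

text \<open>\<open>E2\<close> is orthonormal for the warped fibre metric at \<open>q\<close>, so
  \<open>E1\<close> and \<open>E2\<close> together form an orthonormal frame of the warped product.
  Minimality is stated without projections, by pairing the trace of the second derivative with every
  \<open>y\<close> tangent to the torus and normal to the immersion.\<close>

locale minimal_torus_coordinates = warped_coordinates U GB V GF u \<Phi>
  for U :: "'b::euclidean_space set" and GB and V :: "'f::euclidean_space set" and GF and u
    and \<Phi> :: "'b \<times> 'f \<Rightarrow> 'c::euclidean_space \<times> 'd::euclidean_space" +
  fixes r1 r2 :: real and q :: "'b \<times> 'f" and E1 :: "'b set" and E2 :: "'f set"
  assumes r1: "r1 > 0" and r12: "r1 \<le> r2"
    and torus1: "\<And>q. q \<in> U \<times> V \<Longrightarrow> fst (\<Phi> q) \<bullet> fst (\<Phi> q) = r1\<^sup>2"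
    and torus2: "\<And>q. q \<in> U \<times> V \<Longrightarrow> snd (\<Phi> q) \<bullet> snd (\<Phi> q) = r2\<^sup>2"
    and q: "q \<in> U \<times> V"
    and E1: "finite E1" "card E1 = DIM('b)"
    and E2: "finite E2" "card E2 = DIM('f)"
    and on1: "\<And>v w. v \<in> E1 \<Longrightarrow> w \<in> E1 \<Longrightarrow> GB (fst q) v w = (if v = w then 1 else 0)"
    and on2: "\<And>v w. v \<in> E2 \<Longrightarrow> w \<in> E2 \<Longrightarrow> (u (fst q))\<^sup>2 * GF (snd q) v w = (if v = w then 1 else 0)"
    and minimal: "\<And>y. fst (\<Phi> q) \<bullet> fst y = 0 \<Longrightarrow> snd (\<Phi> q) \<bullet> snd y = 0 \<Longrightarrow>
      (\<And>v. y \<bullet> dderiv \<Phi> v q = 0) \<Longrightarrow>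
      ((\<Sum>e\<in>E1. dderiv (dderiv \<Phi> (e, 0)) (e, 0) q)
        + (\<Sum>z\<in>E2. dderiv (dderiv \<Phi> (0, z)) (0, z) q)) \<bullet> y = 0"
begin

text \<open>\<open>trace1\<close> and \<open>trace2\<close> are the vectors P and Q of the overview:
  traces of full Euclidean second derivatives, with all tangential components retained.\<close>

definition "trace1 = (\<Sum>e\<in>E1. \<Phi>2 (e, 0) (e, 0) q)"
definition "trace2 = (\<Sum>z\<in>E2. \<Phi>2 (0, z) (0, z) q)"
definition "n1 = real DIM('b)"
definition "n2 = real DIM('f)"

lemma fst_q: "fst q \<in> U"
  using q by auto

sublocale frame: orthonormal_coordinates U GB "fst q" E1
  by unfold_locales (auto simp: fst_q E1 on1)

lemma GF_frame: "z \<in> E2 \<Longrightarrow> GF (snd q) z z = 1 / (u (fst q))\<^sup>2"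
  using on2[of z z] u_pos[OF fst_q] by (auto simp: field_simps)

lemma \<Phi>1_frame1: "v \<in> E1 \<Longrightarrow> w \<in> E1 \<Longrightarrow> \<Phi>1 (v, 0) q \<bullet> \<Phi>1 (w, 0) q = (if v = w then 1 else 0)"
  by (simp add: metric_base[OF q] on1)

lemma \<Phi>1_frame2: "v \<in> E2 \<Longrightarrow> w \<in> E2 \<Longrightarrow> \<Phi>1 (0, v) q \<bullet> \<Phi>1 (0, w) q = (if v = w then 1 else 0)"
  by (simp add: metric_fibre[OF q] on2)

text \<open>Since the base metric is induced by \<Phi>, the Christoffel term of
  \<open>divergence_grad\<close> becomes the inner product of \<Phi>'s second derivative along
  \<open>e\<close> with its first derivative along \<open>d\<close>.\<close>

lemma divergence_eq:
  "divergence GB (grad GB u) (fst q)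
    = (\<Sum>e\<in>E1. dderiv (dderiv u e) e (fst q)) - (\<Sum>e\<in>E1. dderiv u e (fst q) * (trace1 \<bullet> \<Phi>1 (e, 0) q))"
proof -
  have dG: "base.dG a v w (fst q)
      = \<Phi>2 (v, 0) (a, 0) q \<bullet> \<Phi>1 (w, 0) q + \<Phi>1 (v, 0) q \<bullet> \<Phi>2 (w, 0) (a, 0) q" for a v w
  proof -
    note d = base.differentiable_G[OF fst_q]
    have "dderiv (\<lambda>q. \<Phi>1 (v, 0) q \<bullet> \<Phi>1 (w, 0) q) (a, 0) q = dderiv (\<lambda>q. GB (fst q) v w) (a, 0) q"
      by (rule dderiv_cong[OF open_UV q metric_base dderiv_fst_comp(2)[OF d]])
    then show ?thesis
      by (simp add: dderiv_fst_comp(1)[OF d] dderiv_inner[OF differentiable_\<Phi>1[OF q] differentiable_\<Phi>1[OF q]])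
  qed
  have "base.dG e d e (fst q) - base.dG d e e (fst q) / 2 = \<Phi>2 (e, 0) (e, 0) q \<bullet> \<Phi>1 (d, 0) q" for e d
    by (simp add: dG \<Phi>2_commute[OF q, of "(d, 0)"] inner_commute)
  then have "divergence GB (grad GB u) (fst q) = (\<Sum>e\<in>E1. dderiv (dderiv u e) e (fst q)
      - (\<Sum>d\<in>E1. dderiv u d (fst q) * (\<Phi>2 (e, 0) (e, 0) q \<bullet> \<Phi>1 (d, 0) q)))"
    by (simp add: frame.divergence_grad[OF smooth_u])
  also have "\<dots> = (\<Sum>e\<in>E1. dderiv (dderiv u e) e (fst q))
      - (\<Sum>e\<in>E1. \<Sum>d\<in>E1. dderiv u d (fst q) * (\<Phi>2 (e, 0) (e, 0) q \<bullet> \<Phi>1 (d, 0) q))"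
    by (rule sum_subtractf)
  also have "(\<Sum>e\<in>E1. \<Sum>d\<in>E1. dderiv u d (fst q) * (\<Phi>2 (e, 0) (e, 0) q \<bullet> \<Phi>1 (d, 0) q))
      = (\<Sum>d\<in>E1. dderiv u d (fst q) * (trace1 \<bullet> \<Phi>1 (d, 0) q))"
    by (subst sum.swap) (simp add: trace1_def inner_sum_left sum_distrib_left)
  finally show ?thesis .
qed

text \<open>Cauchy-Schwarz against the unit vector \<open>\<Phi>1 (0, z) q\<close> bounds the mixed
  second derivative from below by exactly the squared gradient term of \<open>gauss_mixed\<close>.
  These terms cancel, leaving only pure second derivatives of \<open>u\<close>.\<close>

lemma gauss_lower_bound:
  "- n2 * (\<Sum>e\<in>E1. dderiv (dderiv u e) e (fst q)) / u (fst q) \<le> trace1 \<bullet> trace2"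
proof -
  let ?u = "u (fst q)" and ?H = "\<lambda>e. dderiv (dderiv u e) e (fst q)"
  have u: "?u > 0" by (rule u_pos[OF fst_q])
  have "- ?H e / ?u \<le> \<Phi>2 (e, 0) (e, 0) q \<bullet> \<Phi>2 (0, z) (0, z) q" if z: "z \<in> E2" for e z
  proof -
    have "\<Phi>2 (0, z) (e, 0) q \<bullet> \<Phi>1 (0, z) q = dderiv u e (fst q) / ?u"
      using u by (simp add: \<Phi>2_mixed_fibre[OF q] GF_frame[OF z] field_simps power2_eq_square)
    then have "(dderiv u e (fst q) / ?u)\<^sup>2 \<le> \<Phi>2 (0, z) (e, 0) q \<bullet> \<Phi>2 (0, z) (e, 0) q"
      using Cauchy_Schwarz_ineq[of "\<Phi>2 (0, z) (e, 0) q" "\<Phi>1 (0, z) q"] \<Phi>1_frame2[OF z z] by simp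
    moreover have "((dderiv u e (fst q))\<^sup>2 + ?u * ?H e) * (1 / ?u\<^sup>2) = (dderiv u e (fst q) / ?u)\<^sup>2 + ?H e / ?u"
      using u by (simp add: field_simps power2_eq_square)
    ultimately show ?thesis
      using gauss_mixed[OF q, of z e] unfolding GF_frame[OF z] by (simp add: inner_commute)
  qed
  then have "(\<Sum>e\<in>E1. \<Sum>z\<in>E2. - ?H e / ?u) \<le> (\<Sum>e\<in>E1. \<Sum>z\<in>E2. \<Phi>2 (e, 0) (e, 0) q \<bullet> \<Phi>2 (0, z) (0, z) q)"
    by (intro sum_mono)
  also have "\<dots> = trace1 \<bullet> trace2" by (simp add: trace1_def trace2_def inner_sum_left inner_sum_right) (rule sum.swap)
  also have "(\<Sum>e\<in>E1. \<Sum>z\<in>E2. - ?H e / ?u) = - n2 * (\<Sum>e\<in>E1. ?H e) / ?u"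
    by (simp add: E2 n2_def sum_distrib_left sum_divide_distrib sum_negf)
  finally show ?thesis .
qed

text \<open>\<open>N1\<close> and \<open>N2\<close> are the outward unit normals of the two sphere
  factors; they span the normal space of the torus at the image point.\<close>

definition "N1 = (fst (\<Phi> q) /\<^sub>R r1, 0 :: 'd)"
definition "N2 = (0 :: 'c, snd (\<Phi> q) /\<^sub>R r2)"

text \<open>The sum type as index set keeps the three kinds of vectors apart, so that a sum over the
  family splits into a base, a fibre and a normal block.\<close>

definition basis_vector :: "'b + 'f + bool \<Rightarrow> 'c \<times> 'd" where
  "basis_vector i = (case i of Inl e \<Rightarrow> \<Phi>1 (e, 0) q
    | Inr (Inl z) \<Rightarrow> \<Phi>1 (0, z) q
    | Inr (Inr k) \<Rightarrow> if k then N1 else N2)"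

lemma r2: "r2 > 0"
  using r1 r12 by simp

lemmas torus_derivatives =
  dderiv_constant_norm[OF open_UV q smooth_\<Phi> bounded_linear_fst torus1]
  dderiv_constant_norm[OF open_UV q smooth_\<Phi> bounded_linear_snd torus2]

lemma inner_N: "y \<bullet> N1 = fst (\<Phi> q) \<bullet> fst y / r1" "y \<bullet> N2 = snd (\<Phi> q) \<bullet> snd y / r2"
  by (simp_all add: N1_def N2_def inner_Pair_0 inner_commute divide_inverse mult.commute)

lemma \<Phi>1_inner_N: "\<Phi>1 v q \<bullet> N1 = 0" "\<Phi>1 v q \<bullet> N2 = 0"
  by (simp_all add: inner_N torus_derivatives)

lemma \<Phi>2_inner_N:
  "\<Phi>2 v v q \<bullet> N1 = - (fst (\<Phi>1 v q) \<bullet> fst (\<Phi>1 v q)) / r1"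
  "\<Phi>2 v v q \<bullet> N2 = - (snd (\<Phi>1 v q) \<bullet> snd (\<Phi>1 v q)) / r2"
  by (simp_all add: inner_N torus_derivatives)

lemma basis_vector_orthonormal:
  assumes "i \<in> E1 <+> E2 <+> UNIV" and "j \<in> E1 <+> E2 <+> UNIV"
  shows "basis_vector i \<bullet> basis_vector j = (if i = j then 1 else 0)"
proof -
  have N: "N1 \<bullet> N1 = 1" "N2 \<bullet> N2 = 1" "N1 \<bullet> N2 = 0" "N2 \<bullet> N1 = 0"
    using r1 r2 torus1[OF q] torus2[OF q] by (auto simp: N1_def N2_def power2_eq_square field_simps)
  have M: "\<Phi>1 (0, z) q \<bullet> \<Phi>1 (v, 0) q = 0" for v z
    using metric_mixed[OF q, of v z] by (simp add: inner_commute)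
  have M': "N1 \<bullet> \<Phi>1 v q = 0" "N2 \<bullet> \<Phi>1 v q = 0" for v
    using \<Phi>1_inner_N[of v] by (simp_all add: inner_commute)
  show ?thesis using assms
    by (auto simp: basis_vector_def \<Phi>1_frame1 \<Phi>1_frame2 N M M' \<Phi>1_inner_N metric_mixed[OF q]
        split: if_splits)
qed

text \<open>The two frames span the base and fibre directions, so normality to the immersion can be
  tested on them.\<close>

lemma inner_\<Phi>1_eq_0:
  assumes y1: "\<And>e. e \<in> E1 \<Longrightarrow> y \<bullet> \<Phi>1 (e, 0) q = 0" and y2: "\<And>z. z \<in> E2 \<Longrightarrow> y \<bullet> \<Phi>1 (0, z) q = 0"
  shows "y \<bullet> \<Phi>1 v q = 0"
proof -
  have l: "linear (\<lambda>v. y \<bullet> \<Phi>1 v q)"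
  proof -
    note d = linear_dderiv[OF smooth_on_differentiable[OF smooth_\<Phi> q]]
    show ?thesis by (rule linearI) (simp_all add: linear_add[OF d] linear_scale[OF d] inner_add_right)
  qed
  have l1: "linear (\<lambda>v. y \<bullet> \<Phi>1 (v, 0) q)" and l2: "linear (\<lambda>v. y \<bullet> \<Phi>1 (0, v) q)"
    using linear_add[OF l, of "(_, 0)" "(_, 0)"] linear_scale[OF l, of _ "(_, 0)"]
      linear_add[OF l, of "(0, _)" "(0, _)"] linear_scale[OF l, of _ "(0, _)"]
    by (auto intro!: linearI)
  have g: "bilinear (\<lambda>v w. (u (fst q))\<^sup>2 * GF (snd q) v w)"
    using fibre.bilinear_G[of "snd q"] q by (auto simp: bilinear_def intro!: linear_cmult)
  have "y \<bullet> \<Phi>1 (fst v, 0) q = 0"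
    by (subst frame.expansion) (simp add: linear_sum[OF l1] linear_scale[OF l1] y1)
  moreover have "y \<bullet> \<Phi>1 (0, snd v) q = 0"
    by (subst orthonormal_expansion[OF g E2 on2]) (simp_all add: linear_sum[OF l2] linear_scale[OF l2] y2)
  ultimately show ?thesis using linear_add[OF l, of "(fst v, 0)" "(0, snd v)"] by simp
qed

text \<open>Minimality makes the remaining normal parts of the two traces opposite, so
  \<open>inner_le_orthonormal_sum\<close> applies with \<open>basis_vector\<close>. The three blocks
  of the resulting sum are then evaluated separately.\<close>

lemma minimality_upper_bound:
  "trace1 \<bullet> trace2 \<le> - n2 * (\<Sum>e\<in>E1. dderiv u e (fst q) * (trace1 \<bullet> \<Phi>1 (e, 0) q)) / u (fst q) + n1 * n2 / r1\<^sup>2"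
proof -
  let ?I = "E1 <+> E2 <+> (UNIV :: bool set)"
  let ?u = "u (fst q)"
  define S1 where "S1 = (\<Sum>e\<in>E1. fst (\<Phi>1 (e, 0) q) \<bullet> fst (\<Phi>1 (e, 0) q))"
  define S2 where "S2 = (\<Sum>e\<in>E1. snd (\<Phi>1 (e, 0) q) \<bullet> snd (\<Phi>1 (e, 0) q))"
  define T1 where "T1 = (\<Sum>z\<in>E2. fst (\<Phi>1 (0, z) q) \<bullet> fst (\<Phi>1 (0, z) q))"
  define T2 where "T2 = (\<Sum>z\<in>E2. snd (\<Phi>1 (0, z) q) \<bullet> snd (\<Phi>1 (0, z) q))"
  have u: "?u > 0" by (rule u_pos[OF fst_q])
  have "trace1 \<bullet> trace2 \<le> (\<Sum>i\<in>?I. (trace1 \<bullet> basis_vector i) * (trace2 \<bullet> basis_vector i))"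
  proof (rule inner_le_orthonormal_sum)
    show "finite ?I" using E1 E2 by simp
    fix y assume y: "\<And>i. i \<in> ?I \<Longrightarrow> y \<bullet> basis_vector i = 0"
    show "(trace1 + trace2) \<bullet> y = 0" unfolding trace1_def trace2_def
    proof (rule minimal)
      show "fst (\<Phi> q) \<bullet> fst y = 0" "snd (\<Phi> q) \<bullet> snd y = 0"
        using y[of "Inr (Inr True)"] y[of "Inr (Inr False)"] r1 r2
        by (auto simp: basis_vector_def inner_N)
      show "y \<bullet> \<Phi>1 v q = 0" for v
      proof (rule inner_\<Phi>1_eq_0)
        show "y \<bullet> \<Phi>1 (e, 0) q = 0" if "e \<in> E1" for e
          using y[of "Inl e"] that by (auto simp: basis_vector_def)
        show "y \<bullet> \<Phi>1 (0, z) q = 0" if "z \<in> E2" for z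
          using y[of "Inr (Inl z)"] that by (auto simp: basis_vector_def)
      qed
    qed
  qed (rule basis_vector_orthonormal)
  also have "\<dots> = (\<Sum>e\<in>E1. (trace1 \<bullet> \<Phi>1 (e, 0) q) * (trace2 \<bullet> \<Phi>1 (e, 0) q))
      + (\<Sum>z\<in>E2. (trace1 \<bullet> \<Phi>1 (0, z) q) * (trace2 \<bullet> \<Phi>1 (0, z) q))
      + ((trace1 \<bullet> N1) * (trace2 \<bullet> N1) + (trace1 \<bullet> N2) * (trace2 \<bullet> N2))"
    using E1 E2 by (simp add: sum.Plus UNIV_bool basis_vector_def)
  \<comment> \<open>Second derivatives in base directions have no fibre component, so this block
    vanishes.\<close>
  also have "(\<Sum>z\<in>E2. (trace1 \<bullet> \<Phi>1 (0, z) q) * (trace2 \<bullet> \<Phi>1 (0, z) q)) = 0"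
    by (simp add: trace1_def inner_sum_left \<Phi>2_base_fibre[OF q])
  also have "(\<Sum>e\<in>E1. (trace1 \<bullet> \<Phi>1 (e, 0) q) * (trace2 \<bullet> \<Phi>1 (e, 0) q))
      = - n2 * (\<Sum>e\<in>E1. dderiv u e (fst q) * (trace1 \<bullet> \<Phi>1 (e, 0) q)) / ?u"
  proof -
    have "trace2 \<bullet> \<Phi>1 (e, 0) q = - n2 * dderiv u e (fst q) / ?u" for e
    proof -
      have "trace2 \<bullet> \<Phi>1 (e, 0) q = (\<Sum>z\<in>E2. - dderiv u e (fst q) / ?u)"
        unfolding trace2_def inner_sum_left using u
        by (intro sum.cong refl) (simp add: \<Phi>2_fibre_base[OF q] GF_frame power2_eq_square)
      then show ?thesis by (simp add: E2 n2_def)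
    qed
    then show ?thesis by (simp add: sum_distrib_left sum_divide_distrib algebra_simps)
  qed
  \<comment> \<open>The normal components are the squared lengths of the frame projected to each
    sphere factor, divided by the radii. Replacing \<open>r2\<close> by the smaller
    \<open>r1\<close> and adding the nonnegative cross terms \<open>S1 * T2\<close> and
    \<open>S2 * T1\<close> gives the product of the totals \<open>S1 + S2 = n1\<close> and
    \<open>T1 + T2 = n2\<close>.\<close>
  also have "(trace1 \<bullet> N1) * (trace2 \<bullet> N1) + (trace1 \<bullet> N2) * (trace2 \<bullet> N2) \<le> n1 * n2 / r1\<^sup>2"
  proof -
    have "trace1 \<bullet> N1 = - S1 / r1" "trace1 \<bullet> N2 = - S2 / r2" "trace2 \<bullet> N1 = - T1 / r1" "trace2 \<bullet> N2 = - T2 / r2"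
      by (simp_all add: trace1_def trace2_def S1_def S2_def T1_def T2_def inner_sum_left \<Phi>2_inner_N
          sum_divide_distrib sum_negf)
    then have "(trace1 \<bullet> N1) * (trace2 \<bullet> N1) + (trace1 \<bullet> N2) * (trace2 \<bullet> N2) = S1 * T1 / r1\<^sup>2 + S2 * T2 / r2\<^sup>2"
      by (simp add: power2_eq_square)
    moreover have ge: "S1 \<ge> 0" "S2 \<ge> 0" "T1 \<ge> 0" "T2 \<ge> 0"
      by (auto simp: S1_def S2_def T1_def T2_def intro!: sum_nonneg)
    moreover have "S2 * T2 / r2\<^sup>2 \<le> S2 * T2 / r1\<^sup>2"
      using ge r1 r2 r12 by (intro divide_left_mono mult_nonneg_nonneg power_mono mult_pos_pos) auto
    moreover have "S1 * T1 / r1\<^sup>2 + S2 * T2 / r1\<^sup>2 \<le> n1 * n2 / r1\<^sup>2"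
    proof -
      have "S1 + S2 = (\<Sum>e\<in>E1. \<Phi>1 (e, 0) q \<bullet> \<Phi>1 (e, 0) q)"
        by (simp add: S1_def S2_def sum.distrib[symmetric] inner_prod_def)
      then have 1: "S1 + S2 = n1" by (simp add: \<Phi>1_frame1 E1 n1_def)
      have "T1 + T2 = (\<Sum>z\<in>E2. \<Phi>1 (0, z) q \<bullet> \<Phi>1 (0, z) q)"
        by (simp add: T1_def T2_def sum.distrib[symmetric] inner_prod_def)
      then have 2: "T1 + T2 = n2" by (simp add: \<Phi>1_frame2 E2 n2_def)
      have "S1 * T1 + S2 * T2 \<le> (S1 + S2) * (T1 + T2)"
        using ge by (simp add: algebra_simps)
      then show ?thesis unfolding 1 2 add_divide_distrib[symmetric] by (rule divide_right_mono) simp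
    qed
    ultimately show ?thesis by linarith
  qed
  finally show ?thesis by simp
qed

text \<open>The tangential sum in the upper bound is exactly the first-order correction in
  \<open>divergence_eq\<close>, so chaining the bounds leaves the divergence; dividing by
  \<open>n2 > 0\<close> removes the fibre dimension.\<close>

lemma laplacian_bound: "- divergence GB (grad GB u) (fst q) / u (fst q) \<le> n1 / r1\<^sup>2"
proof -
  let ?D = "divergence GB (grad GB u) (fst q) / u (fst q)"
  have n2: "n2 > 0" by (simp add: n2_def)
  have "- n2 * ?D = - n2 * (\<Sum>e\<in>E1. dderiv (dderiv u e) e (fst q)) / u (fst q)
      + n2 * (\<Sum>e\<in>E1. dderiv u e (fst q) * (trace1 \<bullet> \<Phi>1 (e, 0) q)) / u (fst q)"
    by (simp add: divergence_eq diff_divide_distrib right_diff_distrib)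
  also have "\<dots> \<le> n1 * n2 / r1\<^sup>2"
    using gauss_lower_bound minimality_upper_bound by simp
  finally have "n2 * (- ?D) \<le> n2 * (n1 / r1\<^sup>2)" by (simp add: mult.commute)
  then have "- ?D \<le> n1 / r1\<^sup>2" using n2 by (rule mult_left_le_imp_le)
  then show ?thesis by simp
qed

end

section \<open>Tangent spaces and orthogonal projections\<close>

text \<open>Differentiation preserves this family of curves and changes only the vector
  coefficients, hence the induction with these generalised. The speeds \<open>a\<close> and
  \<open>b\<close> serve the two sphere factors.\<close>

lemma smooth_on_trigonometric:
  fixes A B C D :: "'b::real_normed_vector"
  shows "smooth_on S (\<lambda>t::real. cos (a * t) *\<^sub>R A + sin (a * t) *\<^sub>R B + (cos (b * t) *\<^sub>R C + sin (b * t) *\<^sub>R D))"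
proof -
  have "Ck_on k S (\<lambda>t::real. cos (a * t) *\<^sub>R A + sin (a * t) *\<^sub>R B + (cos (b * t) *\<^sub>R C + sin (b * t) *\<^sub>R D))" for k
  proof (induction k arbitrary: A B C D)
    case 0
    show ?case by (simp, intro continuous_intros)
  next
    case (Suc k)
    let ?g = "\<lambda>t::real. cos (a * t) *\<^sub>R A + sin (a * t) *\<^sub>R B + (cos (b * t) *\<^sub>R C + sin (b * t) *\<^sub>R D)"
    let ?g' = "\<lambda>v t. cos (a * t) *\<^sub>R ((a * v) *\<^sub>R B) + sin (a * t) *\<^sub>R (- (a * v) *\<^sub>R A)
      + (cos (b * t) *\<^sub>R ((b * v) *\<^sub>R D) + sin (b * t) *\<^sub>R (- (b * v) *\<^sub>R C))"
    have d: "(?g has_derivative (\<lambda>v. ?g' v t)) (at t)" for t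
      by (auto intro!: derivative_eq_intros simp: algebra_simps)
    have fd: "frechet_derivative ?g (at t) v = ?g' v t" for t v
      using dderiv_eqI[OF d, of v t] by (simp only: dderiv_def)
    show ?case unfolding Ck_on.simps
    proof (intro conjI ballI allI)
      show "?g differentiable (at t)" for t using d[of t] unfolding differentiable_def by blast
      show "Ck_on k S (\<lambda>t. frechet_derivative ?g (at t) v)" for v
        unfolding fd by (rule Suc.IH)
    qed
  qed
  then show ?thesis by (simp add: smooth_on_def)
qed

text \<open>For \<open>u \<noteq> 0\<close>, \<open>B\<close> is \<open>u\<close> rescaled to length
  \<open>r\<close> and \<open>c\<close> is the angular speed \<open>norm u / r\<close>; for
  \<open>u = 0\<close> the curve is constant.\<close>

lemma great_circle:
  fixes x u :: "'a::real_inner"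
  assumes x: "x \<bullet> x = r\<^sup>2" and r: "r > 0" and xu: "x \<bullet> u = 0"
  obtains c B where "c *\<^sub>R B = u"
    and "\<And>t. norm (cos (c * t) *\<^sub>R x + sin (c * t) *\<^sub>R B) = r"
proof (cases "u = 0")
  case True
  have "norm x = r" using x r by (simp add: norm_eq_sqrt_inner)
  then show ?thesis using True by (intro that[of 0 0]) auto
next
  case False
  define B where "B = (r / norm u) *\<^sub>R u"
  have "B \<bullet> B = r\<^sup>2" using False by (simp add: B_def power2_norm_eq_inner[symmetric] power_divide power2_eq_square)
  moreover have "x \<bullet> B = 0" using xu by (simp add: B_def)
  ultimately have "(norm (cos s *\<^sub>R x + sin s *\<^sub>R B))\<^sup>2 = (cos s)\<^sup>2 * r\<^sup>2 + (sin s)\<^sup>2 * r\<^sup>2" for s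
    using x unfolding power2_norm_eq_inner
    by (simp add: inner_add_left inner_add_right inner_commute power2_eq_square)
  then have "(norm (cos s *\<^sub>R x + sin s *\<^sub>R B))\<^sup>2 = r\<^sup>2" for s
    by (simp add: distrib_right[symmetric])
  then have "norm (cos s *\<^sub>R x + sin s *\<^sub>R B) = r" for s
    using r by (simp add: power2_eq_iff_nonneg)
  moreover have "(norm u / r) *\<^sub>R B = u" using False r by (simp add: B_def)
  ultimately show ?thesis by (intro that)
qed

text \<open>A curve on the torus has constant norm in each factor, which gives one inclusion.
  Conversely, a pair of great circles, one per factor, realises every vector of the right-hand side
  as a velocity.\<close>

lemma tangent_space_torus:
  fixes x :: "'c::euclidean_space \<times> 'd::euclidean_space"
  assumes x: "x \<in> sphere 0 r1 \<times> sphere 0 r2" and r: "r1 > 0" "r2 > 0"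
  shows "tangent_space (sphere 0 r1 \<times> sphere 0 r2) x = {u. fst x \<bullet> fst u = 0 \<and> snd x \<bullet> snd u = 0}"
    (is "?T = ?R")
proof (intro set_eqI iffI)
  fix u assume "u \<in> ?T"
  then obtain \<gamma> \<epsilon> where e: "\<epsilon> > 0" and g: "smooth_on {-\<epsilon><..<\<epsilon>} \<gamma>"
    and S: "\<gamma> ` {-\<epsilon><..<\<epsilon>} \<subseteq> sphere 0 r1 \<times> sphere 0 r2" and x: "\<gamma> 0 = x"
    and d: "(\<gamma> has_vector_derivative u) (at (0::real))"
    unfolding tangent_space_def by blast
  have u: "dderiv \<gamma> 1 0 = u" using d dderiv_eqI[of \<gamma> _ 0 1] by (simp add: has_vector_derivative_def)
  have m: "0 \<in> {-\<epsilon><..<\<epsilon>}" using e by simp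
  have c: "fst (\<gamma> t) \<bullet> fst (\<gamma> t) = r1\<^sup>2 \<and> snd (\<gamma> t) \<bullet> snd (\<gamma> t) = r2\<^sup>2" if "t \<in> {-\<epsilon><..<\<epsilon>}" for t
    using S that by (force simp: power2_norm_eq_inner[symmetric])
  show "u \<in> ?R"
    using dderiv_constant_norm(1)[OF _ m g bounded_linear_fst, of "r1\<^sup>2" 1]
      dderiv_constant_norm(1)[OF _ m g bounded_linear_snd, of "r2\<^sup>2" 1] c by (simp add: u x)
next
  fix u assume u: "u \<in> ?R"
  have n: "fst x \<bullet> fst x = r1\<^sup>2" "snd x \<bullet> snd x = r2\<^sup>2"
    using x by (auto simp: power2_norm_eq_inner[symmetric])
  obtain a A where A: "a *\<^sub>R A = fst u" "\<And>t. norm (cos (a * t) *\<^sub>R fst x + sin (a * t) *\<^sub>R A) = r1"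
    using great_circle[OF n(1) r(1), of "fst u"] u by auto
  obtain b B where B: "b *\<^sub>R B = snd u" "\<And>t. norm (cos (b * t) *\<^sub>R snd x + sin (b * t) *\<^sub>R B) = r2"
    using great_circle[OF n(2) r(2), of "snd u"] u by auto
  let ?g = "\<lambda>t. cos (a * t) *\<^sub>R (fst x, 0) + sin (a * t) *\<^sub>R (A, 0)
    + (cos (b * t) *\<^sub>R (0, snd x) + sin (b * t) *\<^sub>R (0, B))"
  have "(?g has_vector_derivative u) (at 0)"
    using A(1) B(1) by (auto intro!: derivative_eq_intros simp: prod_eq_iff)
  moreover have "smooth_on {-1<..<1} ?g" by (rule smooth_on_trigonometric)
  moreover have "?g ` {-1<..<1} \<subseteq> sphere 0 r1 \<times> sphere 0 r2" using A(2) B(2) by auto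
  moreover have "?g 0 = x" by simp
  ultimately show "u \<in> ?T" unfolding tangent_space_def
    by (intro CollectI exI[of _ ?g] exI[of _ 1]) auto
qed

section \<open>Orthogonal projections and orthonormal frames\<close>

lemma orth_proj_subspace:
  assumes V: "subspace V"
  shows "orth_proj V x \<in> V" and "z \<in> V \<Longrightarrow> orth_proj V x \<bullet> z = x \<bullet> z"
proof -
  obtain y n where yz: "y \<in> span V" "\<And>w. w \<in> span V \<Longrightarrow> orthogonal n w" "x = y + n"
    using orthogonal_subspace_decomp_exists[of V x] by blast
  have span: "span V = V" using V by (simp add: span_eq_iff)
  have "orth_proj V x \<in> V \<and> (\<forall>z\<in>V. orthogonal (x - orth_proj V x) z)"
    unfolding orth_proj_def
  proof (rule theI)
    show "y \<in> V \<and> (\<forall>z\<in>V. orthogonal (x - y) z)" using yz span by auto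
    fix y' assume y': "y' \<in> V \<and> (\<forall>z\<in>V. orthogonal (x - y') z)"
    have d: "y' - y \<in> V" using y' yz(1) span V by (auto intro: subspace_diff)
    have "orthogonal (x - y) (y' - y)" "orthogonal (x - y') (y' - y)"
      using yz span d y' by auto
    then have "(y' - y) \<bullet> (y' - y) = 0" by (simp add: orthogonal_def inner_diff_left)
    then show "y' = y" by simp
  qed
  then show "orth_proj V x \<in> V" "z \<in> V \<Longrightarrow> orth_proj V x \<bullet> z = x \<bullet> z"
    by (auto simp: orthogonal_def inner_diff_left)
qed

text \<open>An orthonormal basis of the range is pulled back through \<open>L\<close>, so
  Gram-Schmidt need not be run for the metric itself; \<open>L\<close> will be the differential
  restricted to base or fibre directions.\<close>

lemma orthonormal_frame_exists:
  fixes L :: "'e::euclidean_space \<Rightarrow> 'n::euclidean_space"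
  assumes L: "linear L" and inj: "inj L"
  obtains E where "finite E" "card E = DIM('e)"
    and "\<And>v w. v \<in> E \<Longrightarrow> w \<in> E \<Longrightarrow> L v \<bullet> L w = (if v = w then 1 else 0)"
proof -
  have "subspace (range L)" using L by (simp add: linear_subspace_image)
  then obtain B where B: "B \<subseteq> range L" "pairwise orthogonal B" "\<And>x. x \<in> B \<Longrightarrow> norm x = 1"
    "independent B" "card B = dim (range L)"
    by (rule orthonormal_basis_subspace) blast
  have "dim (range L) = DIM('e)" using dim_image_eq[OF L, of UNIV] inj by simp
  moreover have BB: "x \<bullet> y = (if x = y then 1 else 0)" if "x \<in> B" "y \<in> B" for x y
    using B(2,3) that by (auto simp: pairwise_def orthogonal_def power2_norm_eq_inner[symmetric] dest: norm_eq_1[THEN iffD1])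
  moreover have Linv: "L (inv L x) = x" if "x \<in> B" for x using B(1) that by (auto simp: f_inv_into_f)
  moreover have "inj_on (inv L) B" using Linv by (metis inj_onI)
  ultimately show ?thesis using B(4,5) independent_imp_finite[OF B(4)]
    by (intro that[of "inv L ` B"]) (auto simp: card_image inj_on_eq_iff)
qed

text \<open>\<open>y\<close> lies in both subspaces projected onto, so both projections disappear
  when paired with \<open>y\<close>.\<close>

lemma inner_second_fundamental_form:
  fixes \<phi> :: "'p \<Rightarrow> 'c::euclidean_space \<times> 'd::euclidean_space"
  assumes S: "S = sphere 0 r1 \<times> sphere 0 r2" "r1 > 0" "r2 > 0" and p: "\<phi> p \<in> S"
    and y: "fst (\<phi> p) \<bullet> fst y = 0" "snd (\<phi> p) \<bullet> snd y = 0" "\<And>v. y \<bullet> dmap M \<phi> i p v = 0"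
  shows "second_fundamental_form M S \<phi> i p v w \<bullet> y
    = dderiv (dderiv (\<phi> \<circ> param M i) w) v (chart M i p) \<bullet> y"
proof -
  let ?T = "tangent_space S (\<phi> p)" and ?N = "normal_space M S \<phi> i p"
  have T: "?T = {u. fst (\<phi> p) \<bullet> fst u = 0 \<and> snd (\<phi> p) \<bullet> snd u = 0}"
    using p tangent_space_torus[of "\<phi> p" r1 r2] S by simp
  have sT: "subspace ?T" unfolding T by (auto simp: subspace_def inner_add_right)
  then have sN: "subspace ?N"
    unfolding normal_space_def by (auto simp: subspace_def orthogonal_def inner_add_left)
  have yT: "y \<in> ?T" using y by (simp add: T)
  then have yN: "y \<in> ?N" using y(3) by (simp add: normal_space_def orthogonal_def)
  show ?thesis
    unfolding second_fundamental_form_def ambient_derivative_def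
      orth_proj_subspace(2)[OF sN yN] orth_proj_subspace(2)[OF sT yT]
    by (simp add: dderiv_def[abs_def])
qed

lemma minimal_immersion_normal:
  fixes \<phi> :: "'p \<Rightarrow> 'c::euclidean_space \<times> 'd::euclidean_space"
    and M :: "('p, 'i, 'e::euclidean_space, 'z) riemannian_scheme"
  assumes S: "S = sphere 0 r1 \<times> sphere 0 r2" "r1 > 0" "r2 > 0" and p: "\<phi> p \<in> S"
    and y: "fst (\<phi> p) \<bullet> fst y = 0" "snd (\<phi> p) \<bullet> snd y = 0" "\<And>v. y \<bullet> dmap M \<phi> i p v = 0"
    and min: "minimal_immersion M S \<phi>" "i \<in> charts M" "p \<in> chart_dom M i" "orthonormal_frame_at M i p E"
  shows "(\<Sum>e\<in>E. dderiv (dderiv (\<phi> \<circ> param M i) e) e (chart M i p)) \<bullet> y = 0"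
proof -
  have "mean_curvature M S \<phi> i p E = 0" using min by (auto simp: minimal_immersion_def)
  then have "(\<Sum>e\<in>E. second_fundamental_form M S \<phi> i p e e) \<bullet> y = 0"
    by (simp add: mean_curvature_def)
  then show ?thesis
    unfolding inner_sum_left inner_second_fundamental_form[OF S p y] .
qed

section \<open>Charts\<close>

lemma points_eq_chart_doms:
  assumes "smooth_manifold M"
  shows "points M = (\<Union>i\<in>charts M. chart_dom M i)"
  using assms unfolding smooth_manifold_def by blast

lemma chart_inj:
  assumes "smooth_manifold M" and "i \<in> charts M"
  shows "inj_on (chart M i) (chart_dom M i)"
proof -
  have o: "openin (mtop M) (chart_dom M i)"
    and h: "homeomorphic_map (subtopology (mtop M) (chart_dom M i)) (top_of_set (chart_img M i)) (chart M i)"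
    using assms by (auto simp: smooth_manifold_def)
  show ?thesis
    using homeomorphic_imp_injective_map[OF h] openin_subset[OF o] by (simp add: Int_absorb1)
qed

lemma param_chart:
  assumes "smooth_manifold M" and "i \<in> charts M" and "p \<in> chart_dom M i"
  shows "param M i (chart M i p) = p"
  using chart_inj[OF assms(1,2)] assms(3) by (simp add: param_def)

lemma param_in_dom: "x \<in> chart_img M i \<Longrightarrow> param M i x \<in> chart_dom M i"
  unfolding param_def chart_img_def by (rule inv_into_into)

lemma chart_param: "x \<in> chart_img M i \<Longrightarrow> chart M i (param M i x) = x"
  unfolding param_def chart_img_def by (rule f_inv_into_f)

lemma riemannian_coordinates_chart:
  assumes M: "riemannian_manifold M" and i: "i \<in> charts M"
  shows "riemannian_coordinates (chart_img M i) (local_metric M i)"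
proof
  have *: "bilinear (metric M i p) \<and> (\<forall>v w. metric M i p v w = metric M i p w v) \<and>
      (\<forall>v. v \<noteq> 0 \<longrightarrow> metric M i p v v > 0)" if "p \<in> chart_dom M i" for p
    using M i that unfolding riemannian_manifold_def by blast
  show "open (chart_img M i)" using M i by (auto simp: riemannian_manifold_def smooth_manifold_def)
  show "smooth_on (chart_img M i) (\<lambda>x. local_metric M i x v w)" for v w
    using M i by (auto simp: riemannian_manifold_def local_metric_def)
  fix x v w assume "x \<in> chart_img M i"
  note * = *[OF param_in_dom[OF this]]
  show "bilinear (local_metric M i x)" "local_metric M i x v w = local_metric M i x w v"
    "v \<noteq> 0 \<Longrightarrow> 0 < local_metric M i x v v"
    using * by (auto simp: local_metric_def)
qed

section \<open>Charts of the warped product\<close>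

lemma warped_product_simps:
  "charts (warped_product B f F) = charts B \<times> charts F"
  "chart_dom (warped_product B f F) (i, j) = chart_dom B i \<times> chart_dom F j"
  "chart (warped_product B f F) (i, j) (p, q) = (chart B i p, chart F j q)"
  "metric (warped_product B f F) (i, j) (p, q) v w
    = metric B i p (fst v) (fst w) + (f p)\<^sup>2 * metric F j q (snd v) (snd w)"
  "points (warped_product B f F) = points B \<times> points F"
  by (simp_all add: warped_product_def points_def split: prod.splits)

lemma chart_img_warped:
  "chart_img (warped_product B f F) (i, j) = chart_img B i \<times> chart_img F j"
  by (auto simp: chart_img_def warped_product_simps image_iff)

lemma param_warped:
  assumes B: "smooth_manifold B" "i \<in> charts B" and F: "smooth_manifold F" "j \<in> charts F"
    and x: "x \<in> chart_img B i" and y: "y \<in> chart_img F j"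
  shows "param (warped_product B f F) (i, j) (x, y) = (param B i x, param F j y)"
proof -
  let ?M = "warped_product B f F"
  have "inj_on (chart ?M (i, j)) (chart_dom ?M (i, j))"
    using chart_inj[OF B] chart_inj[OF F] by (auto simp: inj_on_def warped_product_simps)
  moreover have "(param B i x, param F j y) \<in> chart_dom ?M (i, j)"
    using param_in_dom[OF x] param_in_dom[OF y] by (simp add: warped_product_simps)
  moreover have "chart ?M (i, j) (param B i x, param F j y) = (x, y)"
    using chart_param[OF x] chart_param[OF y] by (simp add: warped_product_simps)
  ultimately show ?thesis unfolding param_def[of ?M] by (metis inv_into_f_f)
qed

text \<open>Transfers \<open>laplacian_bound\<close> from coordinates to manifolds by choosing
  charts around the two components of \<open>p\<close> and building orthonormal frames
  there.\<close>

lemma minimal_immersion_laplacian_bound: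
  fixes B :: "('p, 'i, 'b::euclidean_space) riemannian"
    and F :: "('q, 'j, 'f::euclidean_space) riemannian"
    and \<phi> :: "'p \<times> 'q \<Rightarrow> 'c::euclidean_space \<times> 'd::euclidean_space"
  assumes B: "riemannian_manifold B" and F: "riemannian_manifold F"
    and f: "smooth_map B f" "\<forall>b\<in>points B. f b > 0"
    and S: "S = sphere 0 r1 \<times> sphere 0 r2" and r: "0 < r1" "r1 \<le> r2"
    and iso: "isometric_immersion (warped_product B f F) S \<phi>"
    and min: "minimal_immersion (warped_product B f F) S \<phi>"
    and p: "p \<in> points (warped_product B f F)"
  shows "laplacian B f (fst p) / f (fst p) \<le> real DIM('b) / r1\<^sup>2"
proof -
  let ?M = "warped_product B f F"
  note sB = B[unfolded riemannian_manifold_def, THEN conjunct1]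
    and sF = F[unfolded riemannian_manifold_def, THEN conjunct1]
  obtain pB pF where pp: "p = (pB, pF)" "pB \<in> points B" "pF \<in> points F"
    using p by (auto simp: warped_product_simps)
  \<comment> \<open>The same choice as in \<open>laplacian\<close>, so that its value at this point
    unfolds to the divergence in this very chart; the fibre chart may be any.\<close>
  define i where "i = (SOME i. i \<in> charts B \<and> pB \<in> chart_dom B i)"
  have "\<exists>i. i \<in> charts B \<and> pB \<in> chart_dom B i" using points_eq_chart_doms[OF sB] pp(2) by auto
  then have i: "i \<in> charts B" "pB \<in> chart_dom B i"
    unfolding i_def by (metis (mono_tags, lifting) someI_ex)+
  obtain j where j: "j \<in> charts F" "pF \<in> chart_dom F j" using points_eq_chart_doms[OF sF] pp(3) by auto
  define U where "U = chart_img B i"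
  define V where "V = chart_img F j"
  define u where "u = f \<circ> param B i"
  define \<Phi> where "\<Phi> = \<phi> \<circ> param ?M (i, j)"
  define x where "x = chart B i pB"
  define y where "y = chart F j pF"
  have ij: "(i, j) \<in> charts ?M" using i j by (simp add: warped_product_simps)
  have q: "(x, y) \<in> U \<times> V" using i j by (auto simp: U_def V_def x_def y_def chart_img_def)
  have par: "param ?M (i, j) q = (param B i (fst q), param F j (snd q))" if "q \<in> U \<times> V" for q
    using param_warped[OF sB i(1) sF j(1), of "fst q" "snd q" f] that by (auto simp: U_def V_def)
  have dom: "param ?M (i, j) q \<in> chart_dom ?M (i, j)" "chart ?M (i, j) (param ?M (i, j) q) = q"
    if "q \<in> U \<times> V" for q
    using that param_in_dom[of q ?M "(i, j)"] chart_param[of q ?M "(i, j)"]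
    by (auto simp: U_def V_def chart_img_warped)
  have u_pos: "u a > 0" if "a \<in> U" for a
  proof -
    have "param B i a \<in> points B"
      using param_in_dom[of a B i] that i(1) unfolding U_def points_eq_chart_doms[OF sB] by blast
    then show ?thesis using f(2) by (simp add: u_def)
  qed
  have iso_metric: "dmap ?M \<phi> (i, j) p v \<bullet> dmap ?M \<phi> (i, j) p w = metric ?M (i, j) p v w"
    if "p \<in> chart_dom ?M (i, j)" for p v w
    using iso ij that unfolding isometric_immersion_def by blast
  have dmap_eq: "dmap ?M \<phi> (i, j) (param ?M (i, j) q) v = dderiv \<Phi> v q" if "q \<in> U \<times> V" for q v
    by (simp add: dmap_def dom(2)[OF that] dderiv_def \<Phi>_def)
  have isom: "dderiv \<Phi> v q \<bullet> dderiv \<Phi> w q = local_metric B i (fst q) (fst v) (fst w)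
      + (u (fst q))\<^sup>2 * local_metric F j (snd q) (snd v) (snd w)" if "q \<in> U \<times> V" for q v w
    using iso_metric[OF dom(1)[OF that], of v w] unfolding dmap_eq[OF that]
    by (simp add: par[OF that] warped_product_simps local_metric_def u_def)
  have "smooth_on (chart_img ?M (i, j)) \<Phi>"
    using iso ij unfolding isometric_immersion_def smooth_map_def \<Phi>_def by blast
  then have smooth_\<Phi>: "smooth_on (U \<times> V) \<Phi>" by (simp add: chart_img_warped U_def V_def)
  have smooth_u: "smooth_on U u" using f(1) i(1) unfolding smooth_map_def U_def u_def by blast
  interpret warped_coordinates U "local_metric B i" V "local_metric F j" u \<Phi>
  proof (intro warped_coordinates.intro warped_coordinates_axioms.intro)
    show "riemannian_coordinates U (local_metric B i)" "riemannian_coordinates V (local_metric F j)"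
      unfolding U_def V_def by (rule riemannian_coordinates_chart[OF B i(1)] riemannian_coordinates_chart[OF F j(1)])+
  qed (fact smooth_\<Phi> smooth_u u_pos isom)+
  have lin: "linear (\<lambda>v. dderiv \<Phi> v (x, y))"
    by (rule linear_dderiv[OF smooth_on_differentiable[OF smooth_\<Phi> q]])
  have lin1: "linear (\<lambda>v. dderiv \<Phi> (v, 0) (x, y))" and lin2: "linear (\<lambda>v. dderiv \<Phi> (0, v) (x, y))"
    using linear_add[OF lin, of "(_, 0)" "(_, 0)"] linear_scale[OF lin, of _ "(_, 0)"]
      linear_add[OF lin, of "(0, _)" "(0, _)"] linear_scale[OF lin, of _ "(0, _)"]
    by (auto intro!: linearI)
  have xU: "x \<in> U" and yV: "y \<in> V" using q by auto
  have inj1: "inj (\<lambda>v. dderiv \<Phi> (v, 0) (x, y))"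
    unfolding linear_injective_0[OF lin1] using metric_base[OF q] base.pos_G[OF xU]
    by (metis fst_conv inner_zero_left less_irrefl)
  have inj2: "inj (\<lambda>v. dderiv \<Phi> (0, v) (x, y))"
    unfolding linear_injective_0[OF lin2] using metric_fibre[OF q] fibre.pos_G[OF yV] u_pos[OF xU]
    by (metis fst_conv snd_conv inner_zero_left less_irrefl mult_pos_pos zero_less_power)
  obtain E1 where E1: "finite E1" "card E1 = DIM('b)"
    "\<And>v w. v \<in> E1 \<Longrightarrow> w \<in> E1 \<Longrightarrow> dderiv \<Phi> (v, 0) (x, y) \<bullet> dderiv \<Phi> (w, 0) (x, y) = (if v = w then 1 else 0)"
    using orthonormal_frame_exists[OF lin1 inj1] by blast
  obtain E2 where E2: "finite E2" "card E2 = DIM('f)"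
    "\<And>v w. v \<in> E2 \<Longrightarrow> w \<in> E2 \<Longrightarrow> dderiv \<Phi> (0, v) (x, y) \<bullet> dderiv \<Phi> (0, w) (x, y) = (if v = w then 1 else 0)"
    using orthonormal_frame_exists[OF lin2 inj2] by blast
  let ?E = "(\<lambda>v. (v, 0)) ` E1 \<union> (\<lambda>v. (0, v)) ` E2 :: ('b \<times> 'f) set"
  have par_q: "param ?M (i, j) (x, y) = p"
    using par[OF q] param_chart[OF sB i] param_chart[OF sF j] by (simp add: x_def y_def pp)
  have p_dom: "p \<in> chart_dom ?M (i, j)" and chart_p: "chart ?M (i, j) p = (x, y)"
    using dom[OF q] par_q by auto
  have met: "metric ?M (i, j) p v w = dderiv \<Phi> v (x, y) \<bullet> dderiv \<Phi> w (x, y)" for v w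
    using iso_metric[OF p_dom] dmap_eq[OF q] by (simp add: par_q)
  \<comment> \<open>The images of \<open>E1\<close> and \<open>E2\<close> could meet only in the
    zero vector, so excluding it makes the cardinalities add up to the dimension.\<close>
  have "0 \<notin> E1" using E1(3)[of 0 0] linear_0[OF lin1] by auto
  then have disj: "(\<lambda>v. (v, 0)) ` E1 \<inter> (\<lambda>v. (0, v)) ` E2 = {}" by auto
  have inj: "inj_on (\<lambda>v. (v, 0) :: 'b \<times> 'f) E1" "inj_on (\<lambda>v. (0, v) :: 'b \<times> 'f) E2"
    by (auto simp: inj_on_def)
  have frame: "orthonormal_frame_at ?M (i, j) p ?E"
    unfolding orthonormal_frame_at_def
  proof (intro conjI ballI)
    show "finite ?E" using E1 E2 by simp
    show "card ?E = DIM('b \<times> 'f)"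
      using E1 E2 disj inj by (simp add: card_Un_disjoint card_image)
    fix v w assume "v \<in> ?E" "w \<in> ?E"
    then show "metric ?M (i, j) p v w = (if v = w then 1 else 0)"
      unfolding met using E1(3) E2(3) metric_mixed[OF q] \<open>0 \<notin> E1\<close>
      by (auto simp: inner_commute split: if_splits)
  qed
  have torus: "\<Phi> q \<in> S" if "q \<in> U \<times> V" for q
  proof -
    have "param ?M (i, j) q \<in> points ?M"
      using dom(1)[OF that] i(1) j(1)
      unfolding warped_product_simps points_eq_chart_doms[OF sB] points_eq_chart_doms[OF sF] by auto
    then show ?thesis using iso by (auto simp: isometric_immersion_def \<Phi>_def)
  qed
  have \<phi>p: "\<phi> p = \<Phi> (x, y)" using par_q by (simp add: \<Phi>_def)
  interpret minimal_torus_coordinates U "local_metric B i" V "local_metric F j" u \<Phi> r1 r2 "(x, y)" E1 E2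
  proof unfold_locales
    show "fst (\<Phi> q) \<bullet> fst (\<Phi> q) = r1\<^sup>2" "snd (\<Phi> q) \<bullet> snd (\<Phi> q) = r2\<^sup>2" if "q \<in> U \<times> V" for q
      using torus[OF that] by (auto simp: S power2_norm_eq_inner[symmetric])
    show "((\<Sum>e\<in>E1. dderiv (dderiv \<Phi> (e, 0)) (e, 0) (x, y))
        + (\<Sum>z\<in>E2. dderiv (dderiv \<Phi> (0, z)) (0, z) (x, y))) \<bullet> n = 0"
      if n: "fst (\<Phi> (x, y)) \<bullet> fst n = 0" "snd (\<Phi> (x, y)) \<bullet> snd n = 0"
        "\<And>v. n \<bullet> dderiv \<Phi> v (x, y) = 0" for n
    proof -
      have "(\<Sum>e\<in>?E. dderiv (dderiv (\<phi> \<circ> param ?M (i, j)) e) e (chart ?M (i, j) p)) \<bullet> n = 0"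
      proof (rule minimal_immersion_normal[OF S _ _ _ _ _ _ min ij p_dom frame])
        show "n \<bullet> dmap ?M \<phi> (i, j) p v = 0" for v
          using n(3)[of v] dmap_eq[OF q] by (simp add: par_q)
      qed (use n r torus[OF q] in \<open>auto simp: \<phi>p\<close>)
      then show ?thesis
        using E1 E2 disj inj by (simp add: chart_p \<Phi>_def[symmetric] sum.union_disjoint sum.reindex)
    qed
  qed (use r q E1 E2 metric_base[OF q] metric_fibre[OF q] in auto)
  have "u x = f (fst p)" using param_chart[OF sB i] by (simp add: u_def x_def pp)
  moreover have "laplacian B f (fst p) = - divergence (local_metric B i) (grad (local_metric B i) u) x"
    by (simp add: laplacian_def pp i_def[symmetric] Let_def u_def x_def)
  ultimately show ?thesis using laplacian_bound by (simp add: n1_def)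
qed

theorem theorem4p7:
  fixes B :: "('p, 'i, 'b::euclidean_space) riemannian"
    and F :: "('q, 'j, 'f::euclidean_space) riemannian"
    and f :: "'p \<Rightarrow> real"
    and n1 n2 m1 m2 m :: nat
  assumes "riemannian_manifold B" and "riemannian_manifold F"
    and "n1 = DIM('b)" and "n2 = DIM('f)"
    and "smooth_map B f" and "\<forall>b\<in>points B. f b > 0"
    and "m = m1 + m2" and "m \<ge> 4" and "2 \<le> m1" and "real m1 \<le> real m / 2"
    and "DIM('c::euclidean_space) = m1 + 1" and "DIM('d::euclidean_space) = m2 + 1"
  shows "\<not> (\<exists>\<phi> :: 'p \<times> 'q \<Rightarrow> 'c \<times> 'd.
           isometric_immersion (warped_product B f F) (clifford_torus m1 m2) \<phi> \<and>
           minimal_immersion (warped_product B f F) (clifford_torus m1 m2) \<phi> \<and>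
           (\<exists>p\<in>points (warped_product B f F).
              laplacian B f (fst p) / f (fst p) > real n1 * real m / real m1))"
proof (intro notI, elim exE conjE bexE)
  fix \<phi> :: "'p \<times> 'q \<Rightarrow> 'c \<times> 'd" and p
  assume \<phi>: "isometric_immersion (warped_product B f F) (clifford_torus m1 m2) \<phi>"
    "minimal_immersion (warped_product B f F) (clifford_torus m1 m2) \<phi>"
    and p: "p \<in> points (warped_product B f F)"
    and gt: "laplacian B f (fst p) / f (fst p) > real n1 * real m / real m1"
  \<comment> \<open>From \<open>m1 \<le> m / 2\<close> follows \<open>m1 \<le> m2\<close>, so the
    first sphere has the smaller radius, and dividing \<open>n1\<close> by its square
    \<open>m1 / m\<close> gives the claimed constant.\<close>
  have "0 < sqrt (real m1 / real (m1 + m2))" using assms by simp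
  moreover have "sqrt (real m1 / real (m1 + m2)) \<le> sqrt (real m2 / real (m1 + m2))"
    using assms by (intro real_sqrt_le_mono divide_right_mono) auto
  ultimately have "laplacian B f (fst p) / f (fst p) \<le> real n1 / (sqrt (real m1 / real (m1 + m2)))\<^sup>2"
    using minimal_immersion_laplacian_bound[OF assms(1,2,5,6) clifford_torus_def _ _ \<phi> p] assms(3) by simp
  then show False using gt assms(7) by simp
qed

end
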